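(* Let $K$ be a field with a henselian topology $\tau$, and let $B\subseteq K$ be a subset. Then the model-theoretic existential algebraic closure of $B$ in $K$ in the language of rings is a subset of the relative (field-theoretic) algebraic closure of $\Lambda_K\mathbb{F}(B)$ in $K$, where $\mathbb{F}$ is the prime subfield of $K$.
   Context: The existential algebraic closure of $B$ in $K$ is the union of all finite subsets of $K$ that are definable in $K$ by an existential formula of the language of rings with parameters from $B$. Let $p$ be the characteristic exponent of $K$ (the characteristic if positive, else $1$). An extension $F/C$ is separable if $F$ is linearly disjoint from $C^{1/p}$ over $C$. For a field extension $F/D$, $\Lambda_F D$ denotes the smallest subfield $E$ with $D\subseteq E\subseteq F$ such that $F/E$ is separable (it exists by a theorem of Deveney and Mordeson). Henselian topology: a V-topology on $K$ (a field topology induced by a nontrivial absolute value or a nontrivial valuation) that is locally equivalent, in the sense of Prestel and Ziegler, to the topology induced by a nontrivial henselian valuation on some field. Equivalently, a V-topology satisfying the Implicit Function Theorem for polynomials: for every $f\in K[X_0,\dots,X_{m-1},Y]$ and $(e,d)\in K^{m}\times K$ with $f(e,d)=0$ and $\frac{\partial f}{\partial Y}(e,d)\neq0$ there are $\tau$-open $U\ni e$, $V\ni d$ such that $\{f=0\}\cap(U\times V)$ is the graph of a continuous function $U\to V$. *)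

theory Defs
  imports
    "HOL-Analysis.Function_Topology"
    "HOL-Analysis.Product_Topology"
    "HOL-Algebra.Algebraic_Closure_Type"
    "HOL-Library.Poly_Mapping"
begin

section \<open>Existential algebraic closure in the language of rings\<close>

datatype ring_term =
    Var nat | Zero | One | Minus ring_term
  | Plus ring_term ring_term | Times ring_term ring_term

datatype ring_formula =
    Equal ring_term ring_term | Neg ring_formula
  | And ring_formula ring_formula | Or ring_formula ring_formula
  | Exists nat ring_formula

primrec term_val :: "(nat \<Rightarrow> 'a::comm_ring_1) \<Rightarrow> ring_term \<Rightarrow> 'a" where
  "term_val e (Var i) = e i"
| "term_val e Zero = 0"
| "term_val e One = 1"
| "term_val e (Minus t) = - term_val e t"
| "term_val e (Plus s t) = term_val e s + term_val e t"
| "term_val e (Times s t) = term_val e s * term_val e t"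

primrec holds :: "(nat \<Rightarrow> 'a::comm_ring_1) \<Rightarrow> ring_formula \<Rightarrow> bool" where
  "holds e (Equal s t) = (term_val e s = term_val e t)"
| "holds e (Neg \<phi>) = (\<not> holds e \<phi>)"
| "holds e (And \<phi> \<psi>) = (holds e \<phi> \<and> holds e \<psi>)"
| "holds e (Or \<phi> \<psi>) = (holds e \<phi> \<or> holds e \<psi>)"
| "holds e (Exists i \<phi>) = (\<exists>x. holds (e(i := x)) \<phi>)"

primrec term_vars :: "ring_term \<Rightarrow> nat set" where
  "term_vars (Var i) = {i}"
| "term_vars Zero = {}"
| "term_vars One = {}"
| "term_vars (Minus t) = term_vars t"
| "term_vars (Plus s t) = term_vars s \<union> term_vars t"
| "term_vars (Times s t) = term_vars s \<union> term_vars t"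

primrec free_vars :: "ring_formula \<Rightarrow> nat set" where
  "free_vars (Equal s t) = term_vars s \<union> term_vars t"
| "free_vars (Neg \<phi>) = free_vars \<phi>"
| "free_vars (And \<phi> \<psi>) = free_vars \<phi> \<union> free_vars \<psi>"
| "free_vars (Or \<phi> \<psi>) = free_vars \<phi> \<union> free_vars \<psi>"
| "free_vars (Exists i \<phi>) = free_vars \<phi> - {i}"

primrec quantifier_free :: "ring_formula \<Rightarrow> bool" where
  "quantifier_free (Equal s t) = True"
| "quantifier_free (Neg \<phi>) = quantifier_free \<phi>"
| "quantifier_free (And \<phi> \<psi>) = (quantifier_free \<phi> \<and> quantifier_free \<psi>)"
| "quantifier_free (Or \<phi> \<psi>) = (quantifier_free \<phi> \<and> quantifier_free \<psi>)"
| "quantifier_free (Exists i \<phi>) = False"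

inductive existential :: "ring_formula \<Rightarrow> bool" where
  "quantifier_free \<phi> \<Longrightarrow> existential \<phi>"
| "existential \<phi> \<Longrightarrow> existential (Exists i \<phi>)"

text \<open>Variable 0 ranges over the defined set; the other free variables are interpreted
  by parameters from \<open>B\<close>.\<close>

definition existentially_definable :: "'a::field set \<Rightarrow> 'a set \<Rightarrow> bool" where
  "existentially_definable B S \<longleftrightarrow>
     (\<exists>\<phi> e. existential \<phi> \<and> e ` (free_vars \<phi> - {0}) \<subseteq> B \<and> S = {x. holds (e(0 := x)) \<phi>})"

definition existential_algebraic_closure :: "'a::field set \<Rightarrow> 'a set" where
  "existential_algebraic_closure B = \<Union>{S. finite S \<and> existentially_definable B S}"


section \<open>Subfields, separability and \<open>\<Lambda>\<close>\<close>

definition is_subfield :: "'a::field set \<Rightarrow> bool" where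
  "is_subfield E \<longleftrightarrow> 0 \<in> E \<and> 1 \<in> E \<and>
     (\<forall>x\<in>E. - x \<in> E \<and> inverse x \<in> E) \<and> (\<forall>x\<in>E. \<forall>y\<in>E. x + y \<in> E \<and> x * y \<in> E)"

definition prime_subfield :: "'a::field set" where
  "prime_subfield = \<Inter>{E. is_subfield E}"

definition field_adjoin :: "'a::field set \<Rightarrow> 'a set \<Rightarrow> 'a set" where
  "field_adjoin C B = \<Inter>{E. is_subfield E \<and> C \<subseteq> E \<and> B \<subseteq> E}"

definition relative_algebraic_closure :: "'a::field set \<Rightarrow> 'a set" where
  "relative_algebraic_closure C =
     {x. \<exists>p. p \<noteq> 0 \<and> (\<forall>i. poly.coeff p i \<in> C) \<and> poly p x = 0}"

definition linearly_independent_over :: "'a::field set \<Rightarrow> 'a set \<Rightarrow> bool" where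
  "linearly_independent_over C S \<longleftrightarrow>
     (\<forall>T c. finite T \<and> T \<subseteq> S \<and> (\<forall>t\<in>T. c t \<in> C) \<and> (\<Sum>t\<in>T. c t * t) = 0 \<longrightarrow> (\<forall>t\<in>T. c t = 0))"

definition linearly_disjoint_over :: "'a::field set \<Rightarrow> 'a set \<Rightarrow> 'a set \<Rightarrow> bool" where
  "linearly_disjoint_over C F G \<longleftrightarrow>
     (\<forall>S\<subseteq>F. linearly_independent_over C S \<longrightarrow> linearly_independent_over G S)"

definition char_exponent :: "'a::field itself \<Rightarrow> nat" where
  "char_exponent _ = (if CHAR('a) = 0 then 1 else CHAR('a))"

text \<open>The field \<open>C\<^sup>1\<^sup>/\<^sup>p\<close>, formed inside an algebraic closure of the ambient field.\<close>

definition p_root_field :: "'a::field set \<Rightarrow> 'a alg_closure set" where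
  "p_root_field C = {x. x ^ char_exponent TYPE('a) \<in> to_ac ` C}"

definition separable_extension :: "'a::field set \<Rightarrow> 'a set \<Rightarrow> bool" where
  "separable_extension F C \<longleftrightarrow>
     linearly_disjoint_over (to_ac ` C) (to_ac ` F) (p_root_field C)"

text \<open>Least with respect to inclusion; it exists by a theorem of Deveney and Mordeson.\<close>

definition Lambda :: "'a::field set \<Rightarrow> 'a set \<Rightarrow> 'a set" where
  "Lambda F D = (LEAST E. is_subfield E \<and> D \<subseteq> E \<and> E \<subseteq> F \<and> separable_extension F E)"


section \<open>Henselian topologies\<close>

definition field_topology :: "'a::field topology \<Rightarrow> bool" where
  "field_topology \<tau> \<longleftrightarrow> topspace \<tau> = UNIV \<and>
     continuous_map (prod_topology \<tau> \<tau>) \<tau> (\<lambda>(x, y). x + y) \<and>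
     continuous_map (prod_topology \<tau> \<tau>) \<tau> (\<lambda>(x, y). x * y) \<and>
     continuous_map \<tau> \<tau> uminus \<and>
     continuous_map (subtopology \<tau> (- {0})) \<tau> inverse"

definition absolute_value :: "('a::field \<Rightarrow> real) \<Rightarrow> bool" where
  "absolute_value v \<longleftrightarrow> (\<forall>x. 0 \<le> v x) \<and> (\<forall>x. v x = 0 \<longleftrightarrow> x = 0) \<and>
     (\<forall>x y. v (x * y) = v x * v y) \<and> (\<forall>x y. v (x + y) \<le> v x + v y)"

definition induced_by_absolute_value :: "'a::field topology \<Rightarrow> ('a \<Rightarrow> real) \<Rightarrow> bool" where
  "induced_by_absolute_value \<tau> v \<longleftrightarrow>
     (\<forall>U. openin \<tau> U \<longleftrightarrow> (\<forall>x\<in>U. \<exists>\<epsilon>>0. \<forall>y. v (y - x) < \<epsilon> \<longrightarrow> y \<in> U))"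

text \<open>Valuations, with arbitrary ordered abelian value groups, are represented up to equivalence
  by their valuation rings \<open>A = {x. v x \<ge> 0}\<close>; the value group is then the unit group of the field
  modulo that of \<open>A\<close>. For \<open>a \<noteq> 0\<close>, the condition \<open>(y - x) / a \<in> A\<close> says \<open>v (y - x) \<ge> v a\<close>.\<close>

definition valuation_ring :: "'a::field set \<Rightarrow> bool" where
  "valuation_ring A \<longleftrightarrow> 0 \<in> A \<and> 1 \<in> A \<and> (\<forall>x\<in>A. - x \<in> A) \<and>
     (\<forall>x\<in>A. \<forall>y\<in>A. x + y \<in> A \<and> x * y \<in> A) \<and> (\<forall>x. x \<in> A \<or> inverse x \<in> A)"

definition induced_by_valuation_ring :: "'a::field topology \<Rightarrow> 'a set \<Rightarrow> bool" where
  "induced_by_valuation_ring \<tau> A \<longleftrightarrow>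
     (\<forall>U. openin \<tau> U \<longleftrightarrow> (\<forall>x\<in>U. \<exists>a. a \<noteq> 0 \<and> (\<forall>y. (y - x) / a \<in> A \<longrightarrow> y \<in> U)))"

definition V_topology :: "'a::field topology \<Rightarrow> bool" where
  "V_topology \<tau> \<longleftrightarrow> field_topology \<tau> \<and>
     ((\<exists>v. absolute_value v \<and> (\<exists>x. x \<noteq> 0 \<and> v x \<noteq> 1) \<and> induced_by_absolute_value \<tau> v) \<or>
      (\<exists>A. valuation_ring A \<and> A \<noteq> UNIV \<and> induced_by_valuation_ring \<tau> A))"

text \<open>Polynomials in indeterminates indexed by \<^typ>\<open>nat\<close>: a monomial \<^typ>\<open>nat \<Rightarrow>\<^sub>0 nat\<close> records
  the exponents.\<close>

type_synonym 'a mpoly = "(nat \<Rightarrow>\<^sub>0 nat) \<Rightarrow>\<^sub>0 'a"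

definition mpoly_vars :: "'a::field mpoly \<Rightarrow> nat set" where
  "mpoly_vars f = (\<Union>k\<in>Poly_Mapping.keys f. Poly_Mapping.keys k)"

definition mpoly_eval :: "(nat \<Rightarrow> 'a) \<Rightarrow> 'a::field mpoly \<Rightarrow> 'a" where
  "mpoly_eval x f = (\<Sum>k\<in>Poly_Mapping.keys f.
     Poly_Mapping.lookup f k * (\<Prod>i\<in>Poly_Mapping.keys k. x i ^ Poly_Mapping.lookup k i))"

text \<open>An element of \<open>K[X\<^sub>0, \<dots>, X\<^sub>m\<^sub>-\<^sub>1, Y]\<close> is a polynomial in \<open>Y\<close> over
  \<open>K[X\<^sub>0, \<dots>, X\<^sub>m\<^sub>-\<^sub>1]\<close>, so that \<^const>\<open>pderiv\<close> is the partial derivative with respect to \<open>Y\<close>.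
  Points of \<open>K\<^sup>m\<close> are the extensional functions on \<open>{..<m}\<close>.\<close>

definition eval_at :: "'a::field mpoly poly \<Rightarrow> (nat \<Rightarrow> 'a) \<Rightarrow> 'a \<Rightarrow> 'a" where
  "eval_at f x y = poly (map_poly (mpoly_eval x) f) y"

abbreviation power_topology :: "nat \<Rightarrow> 'a topology \<Rightarrow> (nat \<Rightarrow> 'a) topology" where
  "power_topology m \<tau> \<equiv> product_topology (\<lambda>_. \<tau>) {..<m}"

definition polynomial_implicit_function_theorem :: "'a::field topology \<Rightarrow> bool" where
  "polynomial_implicit_function_theorem \<tau> \<longleftrightarrow>
     (\<forall>m (f :: 'a mpoly poly) e d.
        (\<forall>i. mpoly_vars (poly.coeff f i) \<subseteq> {..<m}) \<and> e \<in> {..<m} \<rightarrow>\<^sub>E UNIV \<and>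
        eval_at f e d = 0 \<and> eval_at (pderiv f) e d \<noteq> 0 \<longrightarrow>
        (\<exists>U V g. openin (power_topology m \<tau>) U \<and> e \<in> U \<and> openin \<tau> V \<and> d \<in> V \<and>
           continuous_map (subtopology (power_topology m \<tau>) U) (subtopology \<tau> V) g \<and>
           {(x, y). x \<in> U \<and> y \<in> V \<and> eval_at f x y = 0} = {(x, g x) | x. x \<in> U}))"

text \<open>Henselianity of a V-topology in the form of the implicit function theorem. By Prestel and
  Ziegler, this amounts to local equivalence to the topology of a nontrivial henselian valuation
  on some field.\<close>

definition henselian_topology :: "'a::field topology \<Rightarrow> bool" where
  "henselian_topology \<tau> \<longleftrightarrow> V_topology \<tau> \<and> polynomial_implicit_function_theorem \<tau>"

end

theory Submission
  imports Defs "HOL-Analysis.T1_Spaces"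
begin

text \<open>Let \<open>F\<close> be the prime subfield and \<open>C = \<Lambda>\<^sub>K F(B)\<close>, let \<open>S\<close> be finite
  and existentially definable over \<open>B\<close>, and suppose that \<open>x \<in> S\<close> is transcendental over \<open>C\<close>. Since \<open>K/C\<close> is separable, \<open>x\<close> and the witnesses \<open>Z\<close> for the
  existential quantifiers lie in a tower of simple roots over \<open>C(T)\<close>, where \<open>T\<close> is a separating
  transcendence basis. The exchange property gives \<open>t \<in> T\<close> that is algebraic over \<open>D(x)\<close>, where
  \<open>D = C(T - {t})\<close>. By the implicit function theorem the tower over \<open>D(t)\<close> embeds into the germs of
  continuous functions at \<open>t\<close>, with \<open>D\<close> fixed and \<open>t\<close> sent to the identity. So \<open>x\<close> becomes a
  continuous function whose values near \<open>t\<close> lie in the finite set \<open>S\<close>, hence is locally constant.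
  Then the algebraic relation of \<open>t\<close> over \<open>D(x)\<close> holds for all elements near \<open>t\<close>, which is absurd.\<close>

text \<open>Separability keeps the tower within reach of the implicit function theorem, which says
  nothing about multiple roots. It is defined by linear disjointness inside an algebraic closure;
  the proof works with the equivalent condition, inside K, that elements independent over E have
  p-th powers independent over E. This condition passes to intersections, so the least field in the
  definition of \<open>Lambda\<close> exists. Applied to the monomials of a polynomial relation of
  least degree, it yields a partial derivative that does not vanish. Since x itself need not belong
  to a separating transcendence basis, the point that is moved is a basis element t, and x follows
  as a function of t. Germs are used because each of the infinitely many elements of the tower has
  its own neighbourhood of t on which its identities hold, and no common neighbourhood is at hand.
  So all laws hold eventually, element by element; a formula involves only finitely many elements,
  and for it this is enough.\<close>

section \<open>Subfields and adjunction\<close>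

lemma subfield_0: "is_subfield E \<Longrightarrow> 0 \<in> E"
  and subfield_1: "is_subfield E \<Longrightarrow> 1 \<in> E"
  and subfield_uminus: "is_subfield E \<Longrightarrow> x \<in> E \<Longrightarrow> - x \<in> E"
  and subfield_inverse: "is_subfield E \<Longrightarrow> x \<in> E \<Longrightarrow> inverse x \<in> E"
  and subfield_add: "is_subfield E \<Longrightarrow> x \<in> E \<Longrightarrow> y \<in> E \<Longrightarrow> x + y \<in> E"
  and subfield_mult: "is_subfield E \<Longrightarrow> x \<in> E \<Longrightarrow> y \<in> E \<Longrightarrow> x * y \<in> E"
  by (auto simp: is_subfield_def)

lemma subfield_diff: "is_subfield E \<Longrightarrow> x \<in> E \<Longrightarrow> y \<in> E \<Longrightarrow> x - y \<in> E"
  using subfield_add[of E x "- y"] subfield_uminus[of E y] by simp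

lemma subfield_divide: "is_subfield E \<Longrightarrow> x \<in> E \<Longrightarrow> y \<in> E \<Longrightarrow> x / y \<in> E"
  by (simp add: divide_inverse subfield_mult subfield_inverse)

lemma subfield_power: "is_subfield E \<Longrightarrow> x \<in> E \<Longrightarrow> x ^ n \<in> E"
  by (induction n) (auto intro: subfield_1 subfield_mult)

lemma subfield_sum: "is_subfield E \<Longrightarrow> (\<And>i. i \<in> I \<Longrightarrow> f i \<in> E) \<Longrightarrow> sum f I \<in> E"
  by (induction I rule: infinite_finite_induct) (auto intro: subfield_0 subfield_add)

lemma subfield_of_nat: "is_subfield E \<Longrightarrow> of_nat n \<in> E"
  by (induction n) (auto intro: subfield_0 subfield_1 subfield_add)

lemmas subfield_intros = subfield_0 subfield_1 subfield_uminus subfield_inverse subfield_add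
  subfield_mult subfield_diff subfield_divide subfield_power subfield_sum subfield_of_nat

lemma is_subfield_Inter: "(\<And>E. E \<in> \<E> \<Longrightarrow> is_subfield E) \<Longrightarrow> is_subfield (\<Inter>\<E>)"
  by (auto simp: is_subfield_def)

lemma is_subfield_field_adjoin: "is_subfield (field_adjoin C B)"
  unfolding field_adjoin_def by (rule is_subfield_Inter) auto

lemma field_adjoin_base: "C \<subseteq> field_adjoin C B"
  and field_adjoin_gen: "B \<subseteq> field_adjoin C B"
  by (auto simp: field_adjoin_def)

lemma field_adjoin_least: "is_subfield E \<Longrightarrow> C \<subseteq> E \<Longrightarrow> B \<subseteq> E \<Longrightarrow> field_adjoin C B \<subseteq> E"
  by (auto simp: field_adjoin_def)

lemma field_adjoin_mono: "C \<subseteq> C' \<Longrightarrow> B \<subseteq> B' \<Longrightarrow> field_adjoin C B \<subseteq> field_adjoin C' B'"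
  unfolding field_adjoin_def by (intro Inter_anti_mono) auto

lemma field_adjoin_adjoin: "field_adjoin (field_adjoin C A) B = field_adjoin C (A \<union> B)"
proof (intro equalityI field_adjoin_least is_subfield_field_adjoin)
  show "C \<subseteq> field_adjoin (field_adjoin C A) B"
    using field_adjoin_base[of C A] field_adjoin_base[of "field_adjoin C A" B] by (rule order_trans)
  show "A \<union> B \<subseteq> field_adjoin (field_adjoin C A) B"
    using field_adjoin_gen[of A C] field_adjoin_base[of "field_adjoin C A" B]
      field_adjoin_gen[of B "field_adjoin C A"] by auto
  show "B \<subseteq> field_adjoin C (A \<union> B)" using field_adjoin_gen[of "A \<union> B" C] by simp
qed (use field_adjoin_base field_adjoin_gen[of "A \<union> B" C] in auto)

section \<open>Polynomials with coefficients in a subring\<close>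

definition poly_over :: "'a::field set \<Rightarrow> 'a poly \<Rightarrow> bool" where
  "poly_over E p \<longleftrightarrow> (\<forall>i. poly.coeff p i \<in> E)"

lemma relative_algebraic_closure_iff:
  "x \<in> relative_algebraic_closure C \<longleftrightarrow> (\<exists>p. p \<noteq> 0 \<and> poly_over C p \<and> poly p x = 0)"
  by (simp add: relative_algebraic_closure_def poly_over_def)

lemma poly_over_mono: "poly_over E p \<Longrightarrow> E \<subseteq> F \<Longrightarrow> poly_over F p"
  by (auto simp: poly_over_def)

lemma relative_algebraic_closure_mono:
  "C \<subseteq> D \<Longrightarrow> relative_algebraic_closure C \<subseteq> relative_algebraic_closure D"
  by (metis poly_over_mono relative_algebraic_closure_iff subsetI)

lemma poly_over_pCons [simp]: "poly_over E (pCons a p) \<longleftrightarrow> a \<in> E \<and> poly_over E p"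
  by (auto simp: poly_over_def coeff_pCons split: nat.splits)

lemma poly_over_0: "0 \<in> E \<Longrightarrow> poly_over E 0"
  by (simp add: poly_over_def)

text \<open>Coefficient sets of polynomials are only required to be subrings here, because the
  denominators of the coefficients are cleared below.\<close>

definition is_subring :: "'a::field set \<Rightarrow> bool" where
  "is_subring R \<longleftrightarrow> 0 \<in> R \<and> 1 \<in> R \<and>
     (\<forall>x\<in>R. - x \<in> R) \<and> (\<forall>x\<in>R. \<forall>y\<in>R. x + y \<in> R \<and> x * y \<in> R)"

lemma is_subfield_imp_subring: "is_subfield E \<Longrightarrow> is_subring E"
  by (auto simp: is_subfield_def is_subring_def)

context
  fixes E :: "'a::field set" assumes E: "is_subring E"
begin

lemma poly_over_add: "poly_over E p \<Longrightarrow> poly_over E q \<Longrightarrow> poly_over E (p + q)"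
  using E by (auto simp: poly_over_def is_subring_def)

lemma poly_over_uminus: "poly_over E p \<Longrightarrow> poly_over E (- p)"
  using E by (auto simp: poly_over_def is_subring_def)

lemma poly_over_diff: "poly_over E p \<Longrightarrow> poly_over E q \<Longrightarrow> poly_over E (p - q)"
  using poly_over_add[of p "- q"] poly_over_uminus[of q] by simp

lemma poly_over_smult: "a \<in> E \<Longrightarrow> poly_over E p \<Longrightarrow> poly_over E (smult a p)"
  using E by (auto simp: poly_over_def is_subring_def)

lemma poly_over_mult: "poly_over E p \<Longrightarrow> poly_over E q \<Longrightarrow> poly_over E (p * q)"
proof (induction p)
  case 0
  then show ?case using E by (simp add: poly_over_0 is_subring_def)
next
  case (pCons a p)
  then show ?case
    using E by (auto intro!: poly_over_add poly_over_smult simp: is_subring_def)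
qed

lemma poly_over_1: "poly_over E 1"
  using E by (simp add: one_pCons poly_over_0 is_subring_def)

lemma poly_over_const: "a \<in> E \<Longrightarrow> poly_over E [:a:]"
  using E by (simp add: poly_over_0 is_subring_def)

lemma poly_over_monom: "a \<in> E \<Longrightarrow> poly_over E (Polynomial.monom a n)"
  using E by (auto simp: poly_over_def is_subring_def)

lemma poly_over_sum: "(\<And>i. i \<in> I \<Longrightarrow> poly_over E (f i)) \<Longrightarrow> poly_over E (sum f I)"
  using E by (induction I rule: infinite_finite_induct)
    (auto intro: poly_over_add poly_over_0 simp: is_subring_def)

end

lemma poly_over_eval:
  assumes "is_subfield E" "poly_over E p" "x \<in> E"
  shows "poly p x \<in> E"
  using assms(2) by (induction p) (use assms in \<open>auto intro!: subfield_intros\<close>)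

text \<open>Long division, one coefficient at a time: quotient and remainder arise from the given
  coefficients by operations of the field \<open>E\<close>, so they stay over
  \<open>E\<close>.\<close>

lemma poly_over_division:
  fixes p m :: "'a::field poly"
  assumes E: "is_subfield E" and p: "poly_over E p" and m: "poly_over E m" "m \<noteq> 0"
  shows "\<exists>q r. poly_over E q \<and> poly_over E r \<and> p = m * q + r \<and>
           (r = 0 \<or> Polynomial.degree r < Polynomial.degree m)"
  using p
proof (induction p)
  case 0
  then show ?case using E by (intro exI[of _ 0]) (auto intro: poly_over_0 subfield_0)
next
  case (pCons a p)
  then obtain q r where qr: "poly_over E q" "poly_over E r" "p = m * q + r"
    "r = 0 \<or> Polynomial.degree r < Polynomial.degree m" and a: "a \<in> E" by auto
  note R = is_subfield_imp_subring[OF E]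
  let ?d = "Polynomial.degree m"
  \<comment> \<open>The multiple \<open>c\<close> of \<open>m\<close> cancels the only term of
    \<open>pCons a r\<close> that can reach the degree of \<open>m\<close>.\<close>
  define c where "c = poly.coeff (pCons a r) ?d / lead_coeff m"
  have r': "poly_over E (pCons a r)" using a qr by simp
  have c: "c \<in> E" using r' m E by (auto simp: c_def poly_over_def intro: subfield_divide)
  define s where "s = pCons a r - smult c m"
  have s: "poly_over E s"
    unfolding s_def by (intro poly_over_diff poly_over_smult R c r' m)
  have deg: "Polynomial.degree (pCons a r) \<le> ?d"
    using qr(4) by (auto intro: order_trans[OF degree_pCons_le])
  have "Polynomial.degree s \<le> ?d"
    unfolding s_def using deg by (intro degree_diff_le) auto
  moreover have "poly.coeff s ?d = 0" using m by (simp add: s_def c_def)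
  ultimately have "s = 0 \<or> Polynomial.degree s < ?d"
    by (metis leading_coeff_0_iff le_neq_implies_less)
  moreover have "pCons a p = m * (pCons 0 q + [:c:]) + s"
    by (simp add: s_def qr(3) algebra_simps)
  moreover have "poly_over E (pCons 0 q + [:c:])"
    using E R qr c by (intro poly_over_add) (auto simp: poly_over_0 subfield_0)
  ultimately show ?case using s by blast
qed

text \<open>A polynomial of least degree divides all others, since a nonzero remainder would be
  smaller. The cofactor is again over \<open>E\<close>, which is what allows
  \<open>q = m * s\<close> to be evaluated in germs later.\<close>

lemma minimal_polynomial_exists:
  assumes E: "is_subfield E" and z: "z \<in> relative_algebraic_closure E"
  obtains m where "m \<noteq> 0" "poly_over E m" "poly m z = 0"
    "\<And>q. poly_over E q \<Longrightarrow> poly q z = 0 \<Longrightarrow> \<exists>s. poly_over E s \<and> q = m * s"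
proof -
  let ?P = "\<lambda>m. m \<noteq> 0 \<and> poly_over E m \<and> poly m z = 0"
  from z obtain m0 where "?P m0" by (auto simp: relative_algebraic_closure_iff)
  then obtain m where m: "?P m" and min: "\<And>q. ?P q \<Longrightarrow> Polynomial.degree m \<le> Polynomial.degree q"
    using ex_has_least_nat[of ?P m0 Polynomial.degree] by blast
  show ?thesis
  proof (rule that)
    fix q assume q: "poly_over E q" "poly q z = 0"
    obtain s r where sr: "poly_over E s" "poly_over E r" "q = m * s + r"
      "r = 0 \<or> Polynomial.degree r < Polynomial.degree m"
      using poly_over_division[OF E q(1)] m by blast
    have "poly r z = 0" using q sr(3) m by simp
    then have "r = 0" using min[of r] sr by fastforce
    then show "\<exists>s. poly_over E s \<and> q = m * s" using sr by auto
  qed (use m in auto)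
qed

subsection \<open>Fractions\<close>

definition fractions :: "'a::field set \<Rightarrow> 'a set" where
  "fractions R = {a / b | a b. a \<in> R \<and> b \<in> R \<and> b \<noteq> 0}"

lemma fractionsI: "a \<in> R \<Longrightarrow> b \<in> R \<Longrightarrow> b \<noteq> 0 \<Longrightarrow> a / b \<in> fractions R"
  by (auto simp: fractions_def)

lemma subset_fractions: "is_subring R \<Longrightarrow> R \<subseteq> fractions R"
  using fractionsI[of _ R 1] by (auto simp: is_subring_def)

lemma is_subfield_fractions:
  assumes R: "is_subring R"
  shows "is_subfield (fractions R)"
  unfolding is_subfield_def
proof (intro conjI ballI)
  show "0 \<in> fractions R" "1 \<in> fractions R"
    using subset_fractions[OF R] R by (auto simp: is_subring_def)
next
  fix x assume "x \<in> fractions R"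
  then obtain a b where x: "x = a / b" "a \<in> R" "b \<in> R" "b \<noteq> 0" by (auto simp: fractions_def)
  then show "- x \<in> fractions R"
    using fractionsI[of "- a" R b] R by (auto simp: is_subring_def)
  show "inverse x \<in> fractions R"
  proof (cases "a = 0")
    case True
    then show ?thesis using subset_fractions[OF R] R x by (auto simp: is_subring_def)
  next
    case False
    then show ?thesis using fractionsI[of b R a] x by auto
  qed
next
  fix x y assume "x \<in> fractions R" "y \<in> fractions R"
  then obtain a b c d where x: "x = a / b" "a \<in> R" "b \<in> R" "b \<noteq> 0"
    and y: "y = c / d" "c \<in> R" "d \<in> R" "d \<noteq> 0" by (auto simp: fractions_def)
  have "x + y = (a * d + c * b) / (b * d)" "x * y = (a * c) / (b * d)"
    using x y by (auto simp: field_simps)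
  then show "x + y \<in> fractions R" "x * y \<in> fractions R"
    using x y R by (auto simp: is_subring_def intro!: fractionsI)
qed

lemma clear_denominators:
  assumes R: "is_subring R" and "poly_over (fractions R) p"
  shows "\<exists>d q. d \<in> R \<and> d \<noteq> 0 \<and> poly_over R q \<and> q = smult d p"
  using assms(2)
proof (induction p)
  case 0
  then show ?case using R by (intro exI[of _ 1] exI[of _ 0]) (auto simp: is_subring_def poly_over_0)
next
  case (pCons a p)
  then obtain d q where dq: "d \<in> R" "d \<noteq> 0" "poly_over R q" "q = smult d p" by auto
  from pCons.prems obtain u v where uv: "a = u / v" "u \<in> R" "v \<in> R" "v \<noteq> 0"
    by (auto simp: fractions_def)
  have "smult (d * v) (pCons a p) = pCons (d * u) (smult v q)"
    using uv dq by (simp add: mult.commute)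
  then show ?case using dq uv R
    by (intro exI[of _ "d * v"] exI[of _ "pCons (d * u) (smult v q)"])
      (auto simp: is_subring_def mult.commute simp del: smult_smult intro!: poly_over_smult[OF R])
qed

text \<open>Used to turn a relation over a generated field into one whose coefficients are values of
  polynomials and can be expanded into monomials.\<close>

lemma algebraic_over_fractions:
  assumes R: "is_subring R" and x: "x \<in> relative_algebraic_closure (fractions R)"
  obtains q where "q \<noteq> 0" "poly_over R q" "poly q x = 0"
proof -
  from x obtain p where p: "p \<noteq> 0" "poly_over (fractions R) p" "poly p x = 0"
    by (auto simp: relative_algebraic_closure_iff)
  obtain d where "d \<noteq> 0" "poly_over R (smult d p)"
    using clear_denominators[OF R p(2)] by auto
  then show ?thesis using p by (intro that[of "smult d p"]) auto
qed

section \<open>Simple extensions and the exchange property\<close>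

definition simple_subring :: "'a::field set \<Rightarrow> 'a \<Rightarrow> 'a set" where
  "simple_subring E z = {poly q z | q. poly_over E q}"

lemma is_subring_simple_subring:
  assumes "is_subfield E"
  shows "is_subring (simple_subring E z)"
proof -
  note R = is_subfield_imp_subring[OF assms]
  have "0 \<in> simple_subring E z"
    unfolding simple_subring_def using poly_over_0[OF subfield_0[OF assms]]
    by (intro CollectI exI[of _ 0]) auto
  moreover have "1 \<in> simple_subring E z"
    unfolding simple_subring_def using poly_over_1[OF R]
    by (intro CollectI exI[of _ 1]) auto
  moreover have "- x \<in> simple_subring E z" if "x \<in> simple_subring E z" for x
    using that poly_over_uminus[OF R] by (force simp: simple_subring_def simp flip: poly_minus)
  moreover have "x + y \<in> simple_subring E z" if "x \<in> simple_subring E z" "y \<in> simple_subring E z" for x y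
    using that poly_over_add[OF R] by (force simp: simple_subring_def simp flip: poly_add)
  moreover have "x * y \<in> simple_subring E z" if "x \<in> simple_subring E z" "y \<in> simple_subring E z" for x y
    using that poly_over_mult[OF R] by (force simp: simple_subring_def simp flip: poly_mult)
  ultimately show ?thesis by (auto simp: is_subring_def)
qed

lemma simple_subring_base:
  assumes "is_subfield E"
  shows "E \<subseteq> simple_subring E z" and "z \<in> simple_subring E z"
proof -
  have "poly [:c:] z = c" for c by simp
  then show "E \<subseteq> simple_subring E z"
    unfolding simple_subring_def
    using poly_over_const[OF is_subfield_imp_subring[OF assms]] by (metis (mono_tags, lifting) mem_Collect_eq subsetI)
  show "z \<in> simple_subring E z"
    unfolding simple_subring_def using assms
    by (intro CollectI exI[of _ "[:0, 1:]"]) (auto simp: poly_over_0 subfield_0 subfield_1)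
qed

lemma field_adjoin_subset_fractions:
  assumes "is_subfield E"
  shows "field_adjoin E {z} \<subseteq> fractions (simple_subring E z)"
proof (rule field_adjoin_least)
  note R = is_subring_simple_subring[OF assms, of z]
  show "is_subfield (fractions (simple_subring E z))" by (rule is_subfield_fractions[OF R])
  show "E \<subseteq> fractions (simple_subring E z)" "{z} \<subseteq> fractions (simple_subring E z)"
    using subset_fractions[OF R] simple_subring_base[OF assms, of z] by auto
qed

text \<open>Euclidean descent below the degree of the minimal polynomial \<open>m\<close>: dividing
  \<open>m\<close> by \<open>q\<close> leaves a remainder whose value at \<open>z\<close> is a
  multiple of \<open>q(z)\<close>, so an inverse of that value yields an inverse of
  \<open>q(z)\<close>.\<close>

lemma simple_subring_algebraic_inverse:
  assumes E: "is_subfield E" and z: "z \<in> relative_algebraic_closure E"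
    and q: "poly_over E q" "poly q z \<noteq> 0"
  shows "\<exists>s. poly_over E s \<and> poly s z * poly q z = 1"
proof -
  note R = is_subfield_imp_subring[OF E]
  obtain m where m: "m \<noteq> 0" "poly_over E m" "poly m z = 0"
    and min: "\<And>q. poly_over E q \<Longrightarrow> poly q z = 0 \<Longrightarrow> \<exists>s. poly_over E s \<and> q = m * s"
    using minimal_polynomial_exists[OF E z] by metis
  have small: "\<exists>s. poly_over E s \<and> poly s z * poly q z = 1"
    if "poly_over E q" "poly q z \<noteq> 0" "Polynomial.degree q < Polynomial.degree m" for q
    using that
  proof (induction "Polynomial.degree q" arbitrary: q rule: less_induct)
    case less
    then have q0: "q \<noteq> 0" by auto
    obtain a r where ar: "poly_over E a" "poly_over E r" "m = q * a + r"
      "r = 0 \<or> Polynomial.degree r < Polynomial.degree q"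
      using poly_over_division[OF E m(2) less.prems(1) q0] by blast
    have rz: "poly r z = - (poly q z * poly a z)"
      using m(3) ar(3) by (simp add: eq_neg_iff_add_eq_0 add.commute)
    show ?case
    proof (cases "poly r z = 0")
      case False
      then obtain s where s: "poly_over E s" "poly s z * poly r z = 1"
        using less.hyps[of r] less.prems ar by force
      then have "poly (- (a * s)) z * poly q z = 1"
        using rz by (simp add: algebra_simps)
      then show ?thesis using poly_over_uminus[OF R poly_over_mult[OF R ar(1) s(1)]] by blast
    next
      \<comment> \<open>The descent ends here. Since \<open>q(z) \<noteq> 0\<close>, the quotient
        \<open>a\<close> vanishes at \<open>z\<close> and equals \<open>m * s\<close>; the remainder
        is a multiple of \<open>m\<close> of smaller degree, hence \<open>0\<close>; and
        \<open>m = q * m * s\<close> gives \<open>s * q = 1\<close>.\<close>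
      case True
      then have "poly a z = 0" using rz less.prems by simp
      then obtain s where s: "poly_over E s" "a = m * s" using min ar(1) by blast
      obtain s' where s': "r = m * s'" using min[OF ar(2) True] by blast
      have "r = 0"
      proof (rule ccontr)
        assume "r \<noteq> 0"
        then have "Polynomial.degree m \<le> Polynomial.degree r"
          using s' by (simp add: degree_mult_eq)
        then show False using ar(4) less.prems(3) \<open>r \<noteq> 0\<close> by linarith
      qed
      then have "m * (s * q) = m * 1" using ar(3) s(2) by (simp add: mult_ac)
      then have "s * q = 1" using m(1) by (simp only: mult_cancel_left) simp
      then have "poly s z * poly q z = 1" by (metis poly_mult poly_1)
      then show ?thesis using s by blast
    qed
  qed
  obtain a r where ar: "poly_over E a" "poly_over E r" "q = m * a + r"
    "r = 0 \<or> Polynomial.degree r < Polynomial.degree m"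
    using poly_over_division[OF E q(1) m(2) m(1)] by blast
  then have "poly r z = poly q z" using m by simp
  then show ?thesis using small[of r] ar q by force
qed

lemma field_adjoin_algebraic:
  assumes E: "is_subfield E" and z: "z \<in> relative_algebraic_closure E"
  shows "field_adjoin E {z} = simple_subring E z"
proof (rule equalityI)
  show "field_adjoin E {z} \<subseteq> simple_subring E z"
  proof (rule field_adjoin_least)
    have "inverse x \<in> simple_subring E z" if "x \<in> simple_subring E z" for x
    proof (cases "x = 0")
      case False
      from that obtain q where q: "poly_over E q" "x = poly q z" by (auto simp: simple_subring_def)
      then obtain s where "poly_over E s" "poly s z * x = 1"
        using simple_subring_algebraic_inverse[OF E z q(1)] False by auto
      then show ?thesis by (auto simp: simple_subring_def dest: inverse_unique[of x "poly s z" for s, OF trans[OF mult.commute]])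
    qed (use that in simp)
    then show "is_subfield (simple_subring E z)"
      using is_subring_simple_subring[OF E, of z] by (auto simp: is_subfield_def is_subring_def)
  qed (use simple_subring_base[OF E] in auto)
  show "simple_subring E z \<subseteq> field_adjoin E {z}"
    using poly_over_eval[OF is_subfield_field_adjoin poly_over_mono[OF _ field_adjoin_base]]
      field_adjoin_gen by (fastforce simp: simple_subring_def)
qed

text \<open>A relation of \<open>x\<close> over \<open>E[t]\<close> is a polynomial in two variables
  over \<open>E\<close>. Read by powers of \<open>t\<close> instead of powers of \<open>x\<close>,
  it becomes a relation of \<open>t\<close> over \<open>E(x)\<close>.\<close>

lemma algebraic_exchange:
  assumes E: "is_subfield E" and x: "x \<in> relative_algebraic_closure (field_adjoin E {t})"
    and nx: "x \<notin> relative_algebraic_closure E"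
  shows "t \<in> relative_algebraic_closure (field_adjoin E {x})"
proof -
  have "x \<in> relative_algebraic_closure (fractions (simple_subring E t))"
    using x relative_algebraic_closure_mono[OF field_adjoin_subset_fractions[OF E]] by blast
  then obtain Q where Q: "Q \<noteq> 0" "poly_over (simple_subring E t) Q" "poly Q x = 0"
    using algebraic_over_fractions[OF is_subring_simple_subring[OF E]] by metis
  have "poly.coeff Q i \<in> simple_subring E t" for i using Q(2) by (simp add: poly_over_def)
  then have "\<forall>i. \<exists>a. poly_over E a \<and> poly.coeff Q i = poly a t"
    unfolding simple_subring_def by blast
  then obtain a where a: "\<And>i. poly_over E (a i)" "\<And>i. poly.coeff Q i = poly (a i) t"
    by metis
  define N where "N = Polynomial.degree Q"
  define M where "M = Max ((\<lambda>i. Polynomial.degree (a i)) ` {..N})"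
  have M: "Polynomial.degree (a i) \<le> M" if "i \<le> N" for i
    unfolding M_def by (intro Max_ge) (use that in auto)
  \<comment> \<open>\<open>b j\<close> is the coefficient of the \<open>j\<close>-th power of
    \<open>t\<close>, as a polynomial in \<open>x\<close>.\<close>
  define b where "b j = (\<Sum>i\<le>N. Polynomial.monom (poly.coeff (a i) j) i)" for j
  have b: "poly_over E (b j)" for j
    unfolding b_def using is_subfield_imp_subring[OF E] a(1)
    by (intro poly_over_sum poly_over_monom) (auto simp: poly_over_def)
  define S where "S = (\<Sum>j\<le>M. Polynomial.monom (poly (b j) x) j)"
  have xin: "x \<in> field_adjoin E {x}" using field_adjoin_gen by blast
  have S: "poly_over (field_adjoin E {x}) S"
    unfolding S_def
    by (intro poly_over_sum poly_over_monom is_subfield_imp_subring is_subfield_field_adjoin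
        poly_over_eval xin poly_over_mono[OF b] field_adjoin_base)
  have cb: "poly.coeff (b j) i = (if i \<le> N then poly.coeff (a i) j else 0)" for i j
    by (simp add: b_def coeff_sum)
  have cS: "poly.coeff S j = (if j \<le> M then poly (b j) x else 0)" for j
    by (simp add: S_def coeff_sum)
  have "poly S t = (\<Sum>j\<le>M. \<Sum>i\<le>N. poly.coeff (a i) j * x ^ i * t ^ j)"
    by (simp add: S_def b_def poly_sum poly_monom sum_distrib_right)
  also have "\<dots> = (\<Sum>i\<le>N. \<Sum>j\<le>M. poly.coeff (a i) j * x ^ i * t ^ j)"
    by (rule sum.swap)
  also have "\<dots> = (\<Sum>i\<le>N. poly.coeff Q i * x ^ i)"
  proof (rule sum.cong)
    fix i assume "i \<in> {..N}"
    then have "poly (a i) t = (\<Sum>j\<le>M. poly.coeff (a i) j * t ^ j)"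
      using M[of i] by (subst poly_altdef, intro sum.mono_neutral_left) (auto simp: coeff_eq_0)
    then show "(\<Sum>j\<le>M. poly.coeff (a i) j * x ^ i * t ^ j) = poly.coeff Q i * x ^ i"
      by (simp add: a(2) sum_distrib_left mult_ac)
  qed simp
  also have "\<dots> = 0" using Q(3) by (simp add: poly_altdef N_def)
  finally have root: "poly S t = 0" .
  \<comment> \<open>Transcendence of \<open>x\<close> enters here: if every \<open>b j\<close>
    vanished at \<open>x\<close>, every \<open>b j\<close> would be zero, and with them all
    coefficients of \<open>Q\<close>.\<close>
  have "S \<noteq> 0"
  proof
    assume "S = 0"
    then have "poly (b j) x = 0" if "j \<le> M" for j using cS[of j] that by simp
    then have b0: "b j = 0" if "j \<le> M" for j
      using nx b that by (auto simp: relative_algebraic_closure_iff)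
    have "a i = 0" if "i \<le> N" for i
    proof (rule poly_eqI)
      fix j show "poly.coeff (a i) j = poly.coeff 0 j"
        using b0[of j] cb[of j i] that M[OF that] by (cases "j \<le> M") (auto simp: coeff_eq_0)
    qed
    then have "poly.coeff Q N = 0" using a(2) by simp
    then show False using Q(1) by (simp add: N_def)
  qed
  then show ?thesis using S root by (auto simp: relative_algebraic_closure_iff)
qed

subsection \<open>Finite dimension\<close>

definition lin_span :: "'a::field set \<Rightarrow> 'a set \<Rightarrow> 'a set" where
  "lin_span E V = {\<Sum>v\<in>V. a v * v | a. \<forall>v. a v \<in> E}"

lemma lin_span_mult:
  assumes "is_subfield E" "c \<in> E" "x \<in> lin_span E V"
  shows "c * x \<in> lin_span E V"
proof -
  from assms obtain a where "x = (\<Sum>v\<in>V. a v * v)" "\<forall>v. a v \<in> E" by (auto simp: lin_span_def)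
  then show ?thesis unfolding lin_span_def using assms
    by (intro CollectI exI[of _ "\<lambda>v. c * a v"]) (auto simp: sum_distrib_left mult_ac intro: subfield_mult)
qed

lemma lin_span_add:
  assumes "is_subfield E" "x \<in> lin_span E V" "y \<in> lin_span E V"
  shows "x + y \<in> lin_span E V"
proof -
  from assms obtain a b where "x = (\<Sum>v\<in>V. a v * v)" "\<forall>v. a v \<in> E"
    "y = (\<Sum>v\<in>V. b v * v)" "\<forall>v. b v \<in> E" by (auto simp: lin_span_def)
  then show ?thesis unfolding lin_span_def using assms
    by (intro CollectI exI[of _ "\<lambda>v. a v + b v"])
      (auto simp: sum.distrib algebra_simps intro: subfield_add)
qed

lemma lin_span_sum:
  assumes "is_subfield E" "\<And>i. i \<in> I \<Longrightarrow> f i \<in> lin_span E V"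
  shows "sum f I \<in> lin_span E V"
proof -
  have "0 \<in> lin_span E V" unfolding lin_span_def using assms(1)
    by (intro CollectI exI[of _ "\<lambda>_. 0"]) (auto intro: subfield_0)
  then show ?thesis using assms(2)
    by (induction I rule: infinite_finite_induct) (auto intro: lin_span_add[OF assms(1)])
qed

lemma lin_span_gen:
  assumes "is_subfield E" "finite V" "v \<in> V"
  shows "v \<in> lin_span E V"
  unfolding lin_span_def
  by (intro CollectI exI[of _ "\<lambda>w. if w = v then 1 else 0"])
    (use assms in \<open>auto simp: sum.delta if_distrib[of "\<lambda>a. a * _"] subfield_0 subfield_1 cong: if_cong\<close>)

text \<open>Gaussian elimination, with equations indexed by \<open>V\<close> and unknowns by
  \<open>J\<close>: each step drops a trivial equation or uses one to eliminate an unknown.\<close>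

lemma homogeneous_system_nontrivial_solution:
  assumes E: "is_subfield E" and "finite V" "finite J" "card V < card J"
    and "\<forall>j\<in>J. \<forall>v\<in>V. f j v \<in> E"
  shows "\<exists>c. (\<forall>j. c j \<in> E) \<and> (\<exists>j\<in>J. c j \<noteq> 0) \<and> (\<forall>v\<in>V. (\<Sum>j\<in>J. c j * f j v) = 0)"
  using assms(2-)
proof (induction V arbitrary: J f rule: finite_induct)
  case empty
  then obtain j where "j \<in> J" by fastforce
  then show ?case using E by (intro exI[of _ "\<lambda>_. 1"]) (auto intro: subfield_1)
next
  case (insert w V)
  show ?case
  proof (cases "\<forall>j\<in>J. f j w = 0")
    case True
    have "\<exists>c. (\<forall>j. c j \<in> E) \<and> (\<exists>j\<in>J. c j \<noteq> 0) \<and> (\<forall>v\<in>V. (\<Sum>j\<in>J. c j * f j v) = 0)"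
      using insert by (intro insert.IH) auto
    then show ?thesis using True by auto
  next
    case False
    then obtain k where k: "k \<in> J" "f k w \<noteq> 0" by auto
    define f' where "f' j v = f j v - f j w / f k w * f k v" for j v
    have "\<exists>c. (\<forall>j. c j \<in> E) \<and> (\<exists>j\<in>J - {k}. c j \<noteq> 0) \<and> (\<forall>v\<in>V. (\<Sum>j\<in>J - {k}. c j * f' j v) = 0)"
      using insert k E by (intro insert.IH) (auto simp: f'_def intro!: subfield_intros)
    then obtain c where c: "\<And>j. c j \<in> E" "\<exists>j\<in>J - {k}. c j \<noteq> 0"
      "\<And>v. v \<in> V \<Longrightarrow> (\<Sum>j\<in>J - {k}. c j * f' j v) = 0" by auto
    \<comment> \<open>The value at the pivot \<open>k\<close> is the one that makes equation
      \<open>w\<close> hold; \<open>f'\<close> is the system after elimination of this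
      unknown.\<close>
    define d where "d = c(k := - (\<Sum>j\<in>J - {k}. c j * f j w / f k w))"
    have split: "(\<Sum>j\<in>J. d j * f j v) = (\<Sum>j\<in>J - {k}. c j * f' j v)" for v
    proof -
      have "(\<Sum>j\<in>J. d j * f j v) = d k * f k v + (\<Sum>j\<in>J - {k}. d j * f j v)"
        using insert.prems(1) k(1) by (rule sum.remove)
      also have "(\<Sum>j\<in>J - {k}. d j * f j v) = (\<Sum>j\<in>J - {k}. c j * f j v)"
        by (rule sum.cong) (auto simp: d_def)
      finally show ?thesis
        by (simp add: d_def f'_def algebra_simps sum_subtractf sum_distrib_left sum_distrib_right)
    qed
    have "f' j w = 0" for j using k by (simp add: f'_def)
    then have "(\<Sum>j\<in>J. d j * f j v) = 0" if "v \<in> insert w V" for v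
      using that c(3) by (auto simp: split)
    moreover have "d j \<in> E" for j
      using c(1) E insert.prems(3) k by (auto simp: d_def intro!: subfield_intros)
    moreover have "\<exists>j\<in>J. d j \<noteq> 0" using c(2) by (auto simp: d_def)
    ultimately show ?thesis by blast
  qed
qed

definition finite_dim :: "'a::field set \<Rightarrow> 'a set \<Rightarrow> bool" where
  "finite_dim E M \<longleftrightarrow> (\<exists>V. finite V \<and> M \<subseteq> lin_span E V)"

lemma finite_dim_refl: "is_subfield E \<Longrightarrow> finite_dim E E"
  unfolding finite_dim_def lin_span_def
  by (intro exI[of _ "{1}"] conjI subsetI CollectI exI[of _ "\<lambda>_. x" for x]) auto

lemma finite_dim_algebraic:
  assumes E: "is_subfield E" and M: "is_subfield M" "finite_dim E M" "x \<in> M"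
  shows "x \<in> relative_algebraic_closure E"
proof -
  from M(2) obtain V where V: "finite V" "M \<subseteq> lin_span E V" by (auto simp: finite_dim_def)
  have "x ^ j \<in> lin_span E V" for j using V(2) subfield_power[OF M(1,3)] by blast
  then have "\<forall>j. \<exists>a. (\<forall>v. a v \<in> E) \<and> x ^ j = (\<Sum>v\<in>V. a v * v)"
    by (auto simp: lin_span_def)
  then obtain f where f: "\<And>j v. f j v \<in> E" "\<And>j. x ^ j = (\<Sum>v\<in>V. f j v * v)" by metis
  \<comment> \<open>A linear dependence among powers of \<open>x\<close>: \<open>{..card V}\<close>
    has \<open>card V + 1\<close> elements, one more than there are generators.\<close>
  obtain c where c: "\<And>j. c j \<in> E" "\<exists>j\<le>card V. c j \<noteq> 0"
    "\<And>v. v \<in> V \<Longrightarrow> (\<Sum>j\<le>card V. c j * f j v) = 0"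
    using homogeneous_system_nontrivial_solution[OF E V(1), of "{..card V}" f] f(1)
    by (metis atMost_iff card_atMost finite_atMost lessI)
  define P where "P = (\<Sum>j\<le>card V. Polynomial.monom (c j) j)"
  have "poly P x = (\<Sum>j\<le>card V. \<Sum>v\<in>V. c j * f j v * v)"
    unfolding P_def poly_sum poly_monom f(2) by (simp add: sum_distrib_left mult_ac)
  also have "\<dots> = (\<Sum>v\<in>V. \<Sum>j\<le>card V. c j * f j v * v)" by (rule sum.swap)
  also have "\<dots> = 0" using c(3) by (simp flip: sum_distrib_right)
  finally have "poly P x = 0" .
  moreover have "poly_over E P"
    unfolding P_def by (intro poly_over_sum poly_over_monom is_subfield_imp_subring E c)
  moreover obtain j where "j \<le> card V" "c j \<noteq> 0" using c(2) by blast
  then have "poly.coeff P j \<noteq> 0" by (simp add: P_def coeff_sum)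
  then have "P \<noteq> 0" by auto
  ultimately show ?thesis by (auto simp: relative_algebraic_closure_iff)
qed

lemma finite_dim_adjoin:
  assumes L: "is_subfield L" and M: "is_subfield M" "finite_dim L M"
    and z: "z \<in> relative_algebraic_closure M"
  shows "finite_dim L (field_adjoin M {z})"
proof -
  from M(2) obtain V where V: "finite V" "M \<subseteq> lin_span L V" by (auto simp: finite_dim_def)
  from z obtain m where m: "m \<noteq> 0" "poly_over M m" "poly m z = 0"
    by (auto simp: relative_algebraic_closure_iff)
  define n where "n = Polynomial.degree m"
  \<comment> \<open>The closed range \<open>{..n}\<close> also covers the remainder
    \<open>0\<close>, of degree \<open>0\<close>, without a separate proof that
    \<open>n > 0\<close>.\<close>
  define W where "W = (\<lambda>(k, v). z ^ k * v) ` ({..n} \<times> V)"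
  have W: "finite W" using V by (simp add: W_def)
  have "x \<in> lin_span L W" if "x \<in> field_adjoin M {z}" for x
  proof -
    from that obtain q where q: "poly_over M q" "x = poly q z"
      using field_adjoin_algebraic[OF M(1) z] by (auto simp: simple_subring_def)
    obtain s r where r: "poly_over M r" "q = m * s + r" "r = 0 \<or> Polynomial.degree r < n"
      using poly_over_division[OF M(1) q(1) m(2) m(1)] by (auto simp: n_def)
    have "x = poly r z" using q r m by simp
    also have "\<dots> = (\<Sum>k\<le>Polynomial.degree r. poly.coeff r k * z ^ k)" by (rule poly_altdef)
    also have "\<dots> \<in> lin_span L W"
    proof (rule lin_span_sum[OF L])
      fix k assume k: "k \<in> {..Polynomial.degree r}"
      have "poly.coeff r k \<in> lin_span L V" using r(1) V(2) by (auto simp: poly_over_def)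
      then obtain a where a: "\<And>v. a v \<in> L" "poly.coeff r k = (\<Sum>v\<in>V. a v * v)"
        by (auto simp: lin_span_def)
      have "poly.coeff r k * z ^ k = (\<Sum>v\<in>V. a v * (z ^ k * v))"
        by (simp add: a sum_distrib_left sum_distrib_right mult_ac)
      also have "\<dots> \<in> lin_span L W"
        using k r(3) W by (intro lin_span_sum lin_span_mult lin_span_gen L a) (force simp: W_def)+
      finally show "poly.coeff r k * z ^ k \<in> lin_span L W" .
    qed
    finally show ?thesis .
  qed
  then show ?thesis using W by (auto simp: finite_dim_def)
qed

subsection \<open>Frobenius\<close>

lemma char_exponent_pos: "char_exponent TYPE('a::field) > 0"
  by (simp add: char_exponent_def)

lemma zero_power_char_exponent [simp]: "(0 :: 'b::semiring_1) ^ char_exponent TYPE('a::field) = 0"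
  by (rule zero_power[OF char_exponent_pos])

lemma frobenius_sum:
  fixes f :: "'b \<Rightarrow> 'a::field"
  shows "(\<Sum>i\<in>I. f i) ^ char_exponent TYPE('a) = (\<Sum>i\<in>I. f i ^ char_exponent TYPE('a))"
proof (cases "CHAR('a) = 0")
  case False
  then show ?thesis
    by (simp add: char_exponent_def prime_CHAR_semidom freshmans_dream_sum)
qed (simp add: char_exponent_def)

lemma frobenius_add:
  fixes x y :: "'a::field"
  shows "(x + y) ^ char_exponent TYPE('a) = x ^ char_exponent TYPE('a) + y ^ char_exponent TYPE('a)"
  using frobenius_sum[of "\<lambda>b. if b then x else y" UNIV] by (simp add: UNIV_bool add.commute)

lemma char_exponent_alg_closure: "char_exponent TYPE('a::field alg_closure) = char_exponent TYPE('a)"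
  by (simp add: char_exponent_def)

text \<open>The field \<open>K^p\<close>. For characteristic exponent \<open>1\<close> it is all of
  \<open>K\<close>, so the intersection argument below does not split by characteristic.\<close>

definition pth_powers :: "'a::field set" where
  "pth_powers = range (\<lambda>x. x ^ char_exponent TYPE('a))"

lemma is_subfield_pth_powers: "is_subfield (pth_powers :: 'a::field set)"
  unfolding is_subfield_def
proof (intro conjI ballI)
  let ?p = "char_exponent TYPE('a)"
  have I: "y ^ ?p \<in> pth_powers" for y :: 'a by (simp add: pth_powers_def)
  show "(0::'a) \<in> pth_powers" using I[of 0] by simp
  show "(1::'a) \<in> pth_powers" using I[of 1] by simp
  fix x :: 'a assume "x \<in> pth_powers"
  then obtain u where u: "x = u ^ ?p" by (auto simp: pth_powers_def)
  \<comment> \<open>Additivity of Frobenius yields the sign without a distinction by the parity of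
    the exponent.\<close>
  have "u ^ ?p + (- u) ^ ?p = 0"
    using frobenius_add[of u "- u"] by simp
  then show "- x \<in> pth_powers" using I[of "- u"] u by (metis eq_neg_iff_add_eq_0 neg_equal_iff_equal add.inverse_inverse)
  show "inverse x \<in> pth_powers" using I[of "inverse u"] u by (simp add: power_inverse)
  fix y :: 'a assume "y \<in> pth_powers"
  then obtain v where v: "y = v ^ ?p" by (auto simp: pth_powers_def)
  show "x + y \<in> pth_powers" using I[of "u + v"] u v by (simp add: frobenius_add)
  show "x * y \<in> pth_powers" using I[of "u * v"] u v by (simp add: power_mult_distrib)
qed

subsection \<open>Linear independence\<close>

lemma linearly_independent_over_finite:
  assumes "0 \<in> F" "finite W"
  shows "linearly_independent_over F W \<longleftrightarrow>
    (\<forall>c. (\<forall>w\<in>W. c w \<in> F) \<and> (\<Sum>w\<in>W. c w * w) = 0 \<longrightarrow> (\<forall>w\<in>W. c w = 0))"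
    (is "_ \<longleftrightarrow> ?R")
proof
  assume "linearly_independent_over F W"
  then show ?R using assms by (auto simp: linearly_independent_over_def)
next
  assume R: ?R
  show "linearly_independent_over F W"
    unfolding linearly_independent_over_def
  proof (intro allI impI)
    fix T c assume T: "finite T \<and> T \<subseteq> W \<and> (\<forall>t\<in>T. c t \<in> F) \<and> (\<Sum>t\<in>T. c t * t) = 0"
    define d where "d w = (if w \<in> T then c w else 0)" for w
    have "(\<Sum>w\<in>W. d w * w) = (\<Sum>t\<in>T. c t * t)"
      using T assms by (intro sum.mono_neutral_cong_right) (auto simp: d_def)
    then have "\<forall>w\<in>W. d w = 0" using R[rule_format, of d] T assms by (auto simp: d_def)
    then show "\<forall>t\<in>T. c t = 0" using T by (auto simp: d_def split: if_splits)
  qed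
qed

lemma linearly_independent_over_subset:
  "linearly_independent_over F S \<Longrightarrow> T \<subseteq> S \<Longrightarrow> linearly_independent_over F T"
  unfolding linearly_independent_over_def by (meson subset_trans)

lemma linearly_independent_overD:
  assumes "linearly_independent_over F W" "finite W" "\<forall>w\<in>W. c w \<in> F"
    "(\<Sum>w\<in>W. c w * w) = 0" "w \<in> W"
  shows "c w = 0"
  using assms unfolding linearly_independent_over_def by blast

text \<open>A maximal independent set between \<open>I\<close> and \<open>Y\<close> spans
  \<open>Y\<close>. Prescribing \<open>I\<close> makes it possible to demand that \<open>1\<close>
  be a basis element.\<close>

lemma extend_to_basis:
  assumes F: "is_subfield F" and Y: "finite Y" and I: "I \<subseteq> Y" "linearly_independent_over F I"
  obtains W where "I \<subseteq> W" "W \<subseteq> Y" "linearly_independent_over F W"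
    "\<And>x. x \<in> Y \<Longrightarrow> \<exists>e. (\<forall>w. e w \<in> F) \<and> x = (\<Sum>w\<in>W. e w * w)"
proof -
  let ?S = "{W. I \<subseteq> W \<and> W \<subseteq> Y \<and> linearly_independent_over F W}"
  have S: "finite ?S" "I \<in> ?S" using Y I by auto
  obtain W where W: "W \<in> ?S" and mx: "\<forall>V\<in>?S. W \<subseteq> V \<longrightarrow> W = V"
    using finite_has_maximal2[OF S] by (elim bexE conjE)
  have finW: "finite W" using W Y finite_subset by blast
  have "\<exists>e. (\<forall>w. e w \<in> F) \<and> x = (\<Sum>w\<in>W. e w * w)" if x: "x \<in> Y" for x
  proof (cases "x \<in> W")
    case True
    then show ?thesis using F finW
      by (intro exI[of _ "\<lambda>w. if w = x then 1 else 0"])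
        (simp add: if_distrib[of "\<lambda>a. a * _"] subfield_0 subfield_1 cong: if_cong)
  next
    case False
    have "\<not> linearly_independent_over F (insert x W)"
    proof
      assume "linearly_independent_over F (insert x W)"
      then have "insert x W = W" using bspec[OF mx, of "insert x W"] W x by auto
      then show False using False by auto
    qed
    then obtain c where c: "\<forall>w\<in>insert x W. c w \<in> F" "(\<Sum>w\<in>insert x W. c w * w) = 0"
      "\<exists>w\<in>insert x W. c w \<noteq> 0"
      using linearly_independent_over_finite[OF subfield_0[OF F], of "insert x W"] finW by auto
    have sum: "c x * x + (\<Sum>w\<in>W. c w * w) = 0" using c(2) False finW by simp
    have cx: "c x \<noteq> 0"
    proof
      assume "c x = 0"
      then have "\<forall>w\<in>W. c w = 0"
        using linearly_independent_overD[of F W c] W finW c(1) sum by auto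
      then show False using c(3) \<open>c x = 0\<close> by auto
    qed
    define e where "e w = (if w \<in> W then - c w / c x else 0)" for w
    have "x = - (\<Sum>w\<in>W. c w * w) / c x"
      using sum cx by (simp add: field_simps eq_neg_iff_add_eq_0)
    also have "\<dots> = (\<Sum>w\<in>W. e w * w)"
      by (simp add: e_def sum_divide_distrib flip: sum_negf)
    finally show ?thesis using c(1) F
      by (intro exI[of _ e]) (auto simp: e_def intro!: subfield_divide subfield_uminus intro: subfield_0)
  qed
  then show ?thesis using that W by blast
qed

subsection \<open>Separability\<close>

text \<open>MacLane's form of separability of \<open>K\<close> over \<open>E\<close>; all elements
  involved lie in \<open>K\<close>.\<close>

definition mac_lane :: "'a::field set \<Rightarrow> bool" where
  "mac_lane E \<longleftrightarrow> (\<forall>T c. finite T \<and> linearly_independent_over E T \<and> (\<forall>t\<in>T. c t \<in> E) \<and>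
     (\<Sum>t\<in>T. c t * t ^ char_exponent TYPE('a)) = 0 \<longrightarrow> (\<forall>t\<in>T. c t = 0))"

lemma linearly_independent_to_ac:
  fixes E T :: "'a::field set"
  assumes "0 \<in> E" "finite T"
  shows "linearly_independent_over (to_ac ` E) (to_ac ` T) \<longleftrightarrow> linearly_independent_over E T"
    (is "?L = ?R")
proof
  have sum: "(\<Sum>w\<in>to_ac ` T. c w * w) = (\<Sum>t\<in>T. c (to_ac t) * to_ac t)" for c
    by (simp add: sum.reindex inj_on_def)
  show ?R if ?L
    unfolding linearly_independent_over_finite[OF assms]
  proof (intro allI impI)
    fix c assume c: "(\<forall>w\<in>T. c w \<in> E) \<and> (\<Sum>w\<in>T. c w * w) = 0"
    have "(\<Sum>w\<in>to_ac ` T. to_ac (c (of_ac w)) * w) = to_ac (\<Sum>w\<in>T. c w * w)"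
      by (simp add: sum to_ac_sum)
    then have "to_ac (c (of_ac (to_ac t))) = 0" if "t \<in> T" for t
      using linearly_independent_overD[OF \<open>?L\<close>, of "\<lambda>w. to_ac (c (of_ac w))" "to_ac t"]
        c assms(2) that by auto
    then show "\<forall>w\<in>T. c w = 0" by simp
  qed
  show ?L if ?R
  proof (subst linearly_independent_over_finite, safe)
    fix c t assume c: "\<forall>w\<in>to_ac ` T. c w \<in> to_ac ` E" "(\<Sum>w\<in>to_ac ` T. c w * w) = 0"
      and t: "t \<in> T"
    have d: "to_ac (of_ac (c (to_ac t))) = c (to_ac t)" if "t \<in> T" for t
      using c(1) that by (intro to_ac_of_ac) blast
    have "to_ac (\<Sum>t\<in>T. of_ac (c (to_ac t)) * t) = 0"
      using c(2) by (simp add: sum to_ac_sum d)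
    then have "(\<Sum>t\<in>T. of_ac (c (to_ac t)) * t) = 0" by simp
    moreover have "of_ac (c (to_ac t)) \<in> E" if "t \<in> T" for t
      using c(1) that d[OF that] by (metis image_iff image_eqI of_ac_to_ac)
    ultimately have "of_ac (c (to_ac t)) = 0"
      using linearly_independent_overD[OF \<open>?R\<close> assms(2), of "\<lambda>t. of_ac (c (to_ac t))"] t by blast
    then show "c (to_ac t) = 0" using d[OF t] by simp
  qed (use assms in \<open>force+\<close>)
qed

lemma alg_closure_nth_root:
  fixes x :: "'a::alg_closed_field" assumes "n > 0"
  obtains y where "y ^ n = x"
  using nth_root_exists[OF assms, of x] by auto

text \<open>Frobenius is additive and injective, so a linear relation with coefficients in the
  \<open>p\<close>-th root field of \<open>E\<close> holds exactly if its \<open>p\<close>-th power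
  holds, and that is a relation over \<open>E\<close> among \<open>p\<close>-th powers.\<close>

lemma separable_extension_iff_mac_lane:
  fixes E :: "'a::field set"
  assumes E: "is_subfield E"
  shows "separable_extension UNIV E \<longleftrightarrow> mac_lane E"
proof
  let ?p = "char_exponent TYPE('a)"
  have frob: "(\<Sum>t\<in>T. f t) ^ ?p = (\<Sum>t\<in>T. f t ^ ?p)" for f :: "'b \<Rightarrow> 'a alg_closure" and T
    using frobenius_sum[of f T] by (simp add: char_exponent_alg_closure)
  have zero: "0 \<in> p_root_field E"
    using subfield_0[OF E] by (force simp: p_root_field_def image_iff)
  show "mac_lane E" if sep: "separable_extension UNIV E"
    unfolding mac_lane_def
  proof (intro allI impI ballI)
    fix T c t
    assume T: "finite T \<and> linearly_independent_over E T \<and> (\<forall>t\<in>T. c t \<in> E) \<and>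
      (\<Sum>t\<in>T. c t * t ^ ?p) = 0" and t: "t \<in> T"
    have "\<forall>x :: 'a alg_closure. \<exists>y. y ^ ?p = x"
      using alg_closure_nth_root[OF char_exponent_pos] by metis
    then obtain r where r: "\<And>x :: 'a alg_closure. r x ^ ?p = x" by metis
    have "linearly_independent_over (p_root_field E) (to_ac ` T)"
      using sep T linearly_independent_to_ac[OF subfield_0[OF E], of T]
      unfolding separable_extension_def linearly_disjoint_over_def by (metis image_mono subset_UNIV)
    moreover have "(\<Sum>w\<in>to_ac ` T. r (to_ac (c (of_ac w))) * w) ^ ?p = 0"
    proof -
      have "(\<Sum>w\<in>to_ac ` T. r (to_ac (c (of_ac w))) * w) ^ ?p
          = (\<Sum>t\<in>T. to_ac (c t * t ^ ?p))"
        by (simp add: frob power_mult_distrib r sum.reindex inj_on_def)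
      also have "\<dots> = to_ac (\<Sum>t\<in>T. c t * t ^ ?p)" by (simp only: to_ac_sum)
      finally show ?thesis using T by simp
    qed
    then have "(\<Sum>w\<in>to_ac ` T. r (to_ac (c (of_ac w))) * w) = 0"
      by (rule power_eq_0_iff[THEN iffD1, THEN conjunct1])
    ultimately have "r (to_ac (c (of_ac (to_ac t)))) = 0"
      using linearly_independent_overD[of "p_root_field E" "to_ac ` T" "\<lambda>w. r (to_ac (c (of_ac w)))" "to_ac t"]
        T t by (auto simp: p_root_field_def r)
    then have "to_ac (c t) = 0" using r[of "to_ac (c t)"] by simp
    then show "c t = 0" by simp
  qed
  show "separable_extension UNIV E" if ml: "mac_lane E"
    unfolding separable_extension_def linearly_disjoint_over_def
  proof (intro allI impI)
    fix S :: "'a alg_closure set"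
    assume S: "S \<subseteq> to_ac ` UNIV" "linearly_independent_over (to_ac ` E) S"
    show "linearly_independent_over (p_root_field E) S"
      unfolding linearly_independent_over_def
    proof (intro allI impI ballI)
      fix T d t assume T: "finite T \<and> T \<subseteq> S \<and> (\<forall>t\<in>T. d t \<in> p_root_field E) \<and> (\<Sum>t\<in>T. d t * t) = 0"
        and t: "t \<in> T"
      define T' where "T' = of_ac ` T"
      have tt: "to_ac (of_ac t) = t" if "t \<in> T" for t using that T S by (intro to_ac_of_ac) auto
      then have T': "T = to_ac ` T'" "finite T'" using T by (auto simp: T'_def image_image)
      have "linearly_independent_over (to_ac ` E) T"
        using linearly_independent_over_subset[OF S(2)] T by blast
      then have li: "linearly_independent_over E T'"
        using linearly_independent_to_ac[OF subfield_0[OF E] T'(2)] T'(1) by simp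
      have "\<forall>t\<in>T'. \<exists>c. c \<in> E \<and> d (to_ac t) ^ ?p = to_ac c"
        using T T'(1) by (auto simp: p_root_field_def)
      then obtain c where c: "\<And>t. t \<in> T' \<Longrightarrow> c t \<in> E" "\<And>t. t \<in> T' \<Longrightarrow> d (to_ac t) ^ ?p = to_ac (c t)"
        by metis
      have "to_ac (\<Sum>t\<in>T'. c t * t ^ ?p) = (\<Sum>t\<in>T. d t * t) ^ ?p"
        by (simp add: frob T'(1) sum.reindex inj_on_def power_mult_distrib c to_ac_sum)
      also have "\<dots> = 0" using T by simp
      finally have "(\<Sum>t\<in>T'. c t * t ^ ?p) = 0" by simp
      then have "\<forall>t\<in>T'. c t = 0" using ml li T'(2) c(1) unfolding mac_lane_def by blast
      then have "d t ^ ?p = 0" using c(2) t T'(1) by auto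
      then show "d t = 0" by simp
    qed
  qed
qed

text \<open>The coefficients of a relation are expressed in a basis \<open>A\<close> of their span over \<open>K\<^sup>p\<close>; the
  coordinates are \<open>p\<close>-th powers of elements that lie in each \<open>E \<in> \<E>\<close> by the MacLane
  property and by uniqueness.\<close>

lemma mac_lane_Inter:
  fixes \<E> :: "'a::field set set"
  assumes \<E>: "\<And>E. E \<in> \<E> \<Longrightarrow> is_subfield E" "\<And>E. E \<in> \<E> \<Longrightarrow> mac_lane E"
  shows "mac_lane (\<Inter>\<E>)"
  unfolding mac_lane_def
proof (intro allI impI ballI)
  let ?p = "char_exponent TYPE('a)"
  fix T c t0
  assume asm: "finite T \<and> linearly_independent_over (\<Inter>\<E>) T \<and> (\<forall>t\<in>T. c t \<in> \<Inter>\<E>) \<and>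
    (\<Sum>t\<in>T. c t * t ^ ?p) = 0" and t0: "t0 \<in> T"
  have "linearly_independent_over pth_powers {}" by (simp add: linearly_independent_over_def)
  \<comment> \<open>Choosing the basis among the coefficients themselves keeps its members inside
    every \<open>E \<in> \<E>\<close>.\<close>
  then obtain A where A: "A \<subseteq> c ` T" "linearly_independent_over pth_powers A"
    and span: "\<And>x. x \<in> c ` T \<Longrightarrow> \<exists>e. (\<forall>w. e w \<in> pth_powers) \<and> x = (\<Sum>w\<in>A. e w * w)"
    using extend_to_basis[OF is_subfield_pth_powers, of "c ` T" "{}"] asm by auto
  have finA: "finite A" using A(1) asm finite_subset by blast
  have "\<exists>l. x = (\<Sum>a\<in>A. l a ^ ?p * a)" if x: "x \<in> c ` T" for x
  proof -
    obtain e where e: "\<And>w. e w \<in> pth_powers" "x = (\<Sum>w\<in>A. e w * w)" using span[OF x] by blast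
    have "\<forall>w. \<exists>u. e w = u ^ ?p" using e(1) by (auto simp: pth_powers_def)
    then obtain l where "\<And>w. e w = l w ^ ?p" by metis
    then show ?thesis using e(2) by auto
  qed
  then obtain l where l: "\<And>x. x \<in> c ` T \<Longrightarrow> x = (\<Sum>a\<in>A. l x a ^ ?p * a)" by metis
  have A0: "d a = 0" if "(\<Sum>a\<in>A. d a ^ ?p * a) = 0" "a \<in> A" for d a
  proof -
    have "d a ^ ?p = 0"
      using that by (intro linearly_independent_overD[OF A(2) finA, of "\<lambda>a. d a ^ ?p"])
        (auto simp: pth_powers_def)
    then show ?thesis by simp
  qed
  have lE: "l x a \<in> E" if x: "x \<in> c ` T" and a: "a \<in> A" and E: "E \<in> \<E>" for x a E
  proof -
    note sE = \<E>(1)[OF E]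
    have xE: "y \<in> E" if "y \<in> c ` T" for y using that asm E by auto
    have "linearly_independent_over E {1}"
      using subfield_0[OF sE] by (simp add: linearly_independent_over_finite)
    then obtain W where W: "{1} \<subseteq> W" "W \<subseteq> insert 1 (l x ` A)" "linearly_independent_over E W"
      and spW: "\<And>y. y \<in> insert 1 (l x ` A) \<Longrightarrow> \<exists>e. (\<forall>w. e w \<in> E) \<and> y = (\<Sum>w\<in>W. e w * w)"
      using extend_to_basis[OF sE, of "insert 1 (l x ` A)" "{1}"] finA by auto
    have finW: "finite W" using W(2) finA by (auto intro: finite_subset)
    have "\<forall>a\<in>A. \<exists>e. (\<forall>w. e w \<in> E) \<and> l x a = (\<Sum>w\<in>W. e w * w)" using spW by blast
    then obtain e where e: "\<And>a w. a \<in> A \<Longrightarrow> e a w \<in> E" "\<And>a. a \<in> A \<Longrightarrow> l x a = (\<Sum>w\<in>W. e a w * w)"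
      by metis
    \<comment> \<open>Comparing the expansion of \<open>x\<close> with \<open>x * 1 ^ p\<close>
      gives a relation among the \<open>p\<close>-th powers of \<open>W\<close> with coefficients
      \<open>d w\<close> in \<open>E\<close>. The coefficient at \<open>1\<close> must vanish, so
      \<open>x\<close> has coordinates \<open>e a 1\<close> in \<open>E\<close>, and uniqueness over
      \<open>K^p\<close> identifies them with \<open>l x a\<close>.\<close>
    define d where "d w = (\<Sum>a\<in>A. e a w ^ ?p * a) - (if w = 1 then x else 0)" for w
    have "x = (\<Sum>a\<in>A. (\<Sum>w\<in>W. e a w * w) ^ ?p * a)" using l[OF x] e(2) by simp
    also have "\<dots> = (\<Sum>a\<in>A. \<Sum>w\<in>W. e a w ^ ?p * a * w ^ ?p)"
      by (simp add: frobenius_sum power_mult_distrib sum_distrib_right sum_distrib_left mult_ac)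
    also have "\<dots> = (\<Sum>w\<in>W. \<Sum>a\<in>A. e a w ^ ?p * a * w ^ ?p)" by (rule sum.swap)
    finally have "(\<Sum>w\<in>W. (\<Sum>a\<in>A. e a w ^ ?p * a) * w ^ ?p) = x"
      by (simp add: sum_distrib_right)
    moreover have "(\<Sum>w\<in>W. (if w = 1 then x else 0) * w ^ ?p) = x"
      using W(1) finW by (simp add: if_distrib[of "\<lambda>a. a * _"] cong: if_cong)
    ultimately have "(\<Sum>w\<in>W. d w * w ^ ?p) = 0"
      by (simp add: d_def algebra_simps sum_subtractf)
    moreover have "d w \<in> E" for w
      unfolding d_def using e(1) sE xE[OF x] xE A(1) by (auto intro!: subfield_intros)
    ultimately have "d 1 = 0"
      using \<E>(2)[OF E] W finW unfolding mac_lane_def by blast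
    then have "(\<Sum>a\<in>A. e a 1 ^ ?p * a) = (\<Sum>a\<in>A. l x a ^ ?p * a)" using l[OF x] by (simp add: d_def)
    moreover have "l x a ^ ?p = (l x a - e a 1) ^ ?p + e a 1 ^ ?p" for a
      using frobenius_add[of "l x a - e a 1" "e a 1"] by simp
    ultimately have "(\<Sum>a\<in>A. (l x a - e a 1) ^ ?p * a) = 0"
      by (simp add: distrib_right sum.distrib)
    then show ?thesis using A0[of "\<lambda>a. l x a - e a 1" a] a e(1) by simp
  qed
  \<comment> \<open>The given relation, regrouped by the basis \<open>A\<close>. Each coordinate is
    the \<open>p\<close>-th power of a linear combination of \<open>T\<close> with coefficients in
    the intersection, and over the intersection \<open>T\<close> is independent.\<close>
  have "(\<Sum>a\<in>A. (\<Sum>t\<in>T. l (c t) a * t) ^ ?p * a) = (\<Sum>a\<in>A. \<Sum>t\<in>T. l (c t) a ^ ?p * a * t ^ ?p)"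
    by (simp add: frobenius_sum power_mult_distrib sum_distrib_right sum_distrib_left mult_ac)
  also have "\<dots> = (\<Sum>t\<in>T. \<Sum>a\<in>A. l (c t) a ^ ?p * a * t ^ ?p)" by (rule sum.swap)
  also have "\<dots> = (\<Sum>t\<in>T. (\<Sum>a\<in>A. l (c t) a ^ ?p * a) * t ^ ?p)" by (simp add: sum_distrib_right)
  also have "\<dots> = (\<Sum>t\<in>T. c t * t ^ ?p)" by (intro sum.cong refl arg_cong2[of _ _ _ _ "(*)"]) (simp flip: l)
  finally have "(\<Sum>a\<in>A. (\<Sum>t\<in>T. l (c t) a * t) ^ ?p * a) = 0" using asm by simp
  then have "(\<Sum>t\<in>T. l (c t) a * t) = 0" if "a \<in> A" for a
    using A0[of "\<lambda>a. \<Sum>t\<in>T. l (c t) a * t"] that by blast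
  then have "l (c t0) a = 0" if "a \<in> A" for a
    using linearly_independent_overD[of "\<Inter>\<E>" T "\<lambda>t. l (c t) a" t0] that asm t0 lE by blast
  then show "c t0 = 0" using l[of "c t0"] t0 by simp
qed

text \<open>\<open>LEAST\<close> is meaningful here because the intersection of all admissible
  fields is itself admissible.\<close>

lemma Lambda_eq_Inter:
  "Lambda UNIV D = \<Inter>{E. is_subfield E \<and> D \<subseteq> E \<and> mac_lane E}" (is "_ = \<Inter>?S")
  unfolding Lambda_def
proof (rule Least_equality)
  have "is_subfield (\<Inter>?S)" by (rule is_subfield_Inter) auto
  moreover have "mac_lane (\<Inter>?S)" by (rule mac_lane_Inter) auto
  ultimately show "is_subfield (\<Inter>?S) \<and> D \<subseteq> \<Inter>?S \<and> \<Inter>?S \<subseteq> UNIV \<and> separable_extension UNIV (\<Inter>?S)"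
    by (auto simp: separable_extension_iff_mac_lane)
qed (auto simp: separable_extension_iff_mac_lane)

lemma Lambda_properties:
  shows "is_subfield (Lambda UNIV D)" "mac_lane (Lambda UNIV D)" "D \<subseteq> Lambda UNIV D"
  unfolding Lambda_eq_Inter by (auto intro!: is_subfield_Inter mac_lane_Inter)

subsection \<open>Algebraic relations of minimal degree\<close>

definition monomial :: "'a::field set \<Rightarrow> ('a \<Rightarrow> nat) \<Rightarrow> 'a" where
  "monomial Z \<alpha> = (\<Prod>z\<in>Z. z ^ \<alpha> z)"

text \<open>Exponents vanish outside of \<open>Z\<close>, so that different exponents are formally different
  monomials.\<close>

definition exponents :: "'a set \<Rightarrow> ('a \<Rightarrow> nat) set" where
  "exponents Z = {\<alpha>. \<forall>z. z \<notin> Z \<longrightarrow> \<alpha> z = 0}"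

definition polynomial_values :: "'a::field set \<Rightarrow> 'a set \<Rightarrow> 'a set" where
  "polynomial_values F Z = {\<Sum>\<alpha>\<in>A. c \<alpha> * monomial Z \<alpha> | A c. finite A \<and> A \<subseteq> exponents Z \<and> (\<forall>\<alpha>. c \<alpha> \<in> F)}"

text \<open>The index set \<open>A\<close> consists of exponents, not of elements of
  \<open>K\<close>: if two different monomials take the same value, their difference is already a
  relation.\<close>

definition algebraic_relation :: "'a::field set \<Rightarrow> 'a set \<Rightarrow> nat \<Rightarrow> bool" where
  "algebraic_relation F Z N \<longleftrightarrow> (\<exists>A c. finite A \<and> A \<subseteq> exponents Z \<and> (\<forall>\<alpha>\<in>A. sum \<alpha> Z \<le> N) \<and>
     (\<forall>\<alpha>\<in>A. c \<alpha> \<in> F) \<and> (\<Sum>\<alpha>\<in>A. c \<alpha> * monomial Z \<alpha>) = 0 \<and> (\<exists>\<alpha>\<in>A. c \<alpha> \<noteq> 0))"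

lemma polynomial_valuesE:
  assumes "r \<in> polynomial_values F Z"
  obtains A c where "finite A" "A \<subseteq> exponents Z" "\<And>\<alpha>. c \<alpha> \<in> F"
    "r = (\<Sum>\<alpha>\<in>A. c \<alpha> * monomial Z \<alpha>)"
  using assms by (auto simp: polynomial_values_def)

lemma monomial_add: "monomial Z (\<lambda>z. \<alpha> z + \<beta> z) = monomial Z \<alpha> * monomial Z \<beta>"
  by (simp add: monomial_def power_add prod.distrib)

lemma monomial_power: "monomial Z (\<lambda>z. n * \<alpha> z) = monomial Z \<alpha> ^ n"
  by (simp add: monomial_def power_mult mult.commute[of n] prod_power_distrib)

lemma monomial_remove:
  "finite Z \<Longrightarrow> z \<in> Z \<Longrightarrow> monomial Z \<alpha> = monomial (Z - {z}) \<alpha> * z ^ \<alpha> z"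
  by (simp add: monomial_def prod.remove mult.commute)

lemma monomial_cong: "(\<And>z. z \<in> Z \<Longrightarrow> \<alpha> z = \<beta> z) \<Longrightarrow> monomial Z \<alpha> = monomial Z \<beta>"
  by (simp add: monomial_def)

lemma monomial_mem:
  assumes "is_subfield E" "Z \<subseteq> E"
  shows "monomial Z \<alpha> \<in> E"
proof -
  have "(\<Prod>z\<in>S. z ^ \<alpha> z) \<in> E" if "S \<subseteq> E" for S
    using that assms by (induction S rule: infinite_finite_induct) (auto intro: subfield_intros)
  then show ?thesis using assms by (simp add: monomial_def)
qed

lemma polynomial_values_add:
  assumes F: "is_subfield F" and "r \<in> polynomial_values F Z" "s \<in> polynomial_values F Z"
  shows "r + s \<in> polynomial_values F Z"
proof -
  from assms obtain A c B d where
    A: "finite A" "A \<subseteq> exponents Z" "\<And>\<alpha>. c \<alpha> \<in> F" "r = (\<Sum>\<alpha>\<in>A. c \<alpha> * monomial Z \<alpha>)" and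
    B: "finite B" "B \<subseteq> exponents Z" "\<And>\<alpha>. d \<alpha> \<in> F" "s = (\<Sum>\<alpha>\<in>B. d \<alpha> * monomial Z \<alpha>)"
    by (auto simp: polynomial_values_def)
  define e where "e \<alpha> = (if \<alpha> \<in> A then c \<alpha> else 0) + (if \<alpha> \<in> B then d \<alpha> else 0)" for \<alpha>
  have "r = (\<Sum>\<alpha>\<in>A \<union> B. (if \<alpha> \<in> A then c \<alpha> else 0) * monomial Z \<alpha>)"
    unfolding A(4) using A(1) B(1) by (intro sum.mono_neutral_cong_left) auto
  moreover have "s = (\<Sum>\<alpha>\<in>A \<union> B. (if \<alpha> \<in> B then d \<alpha> else 0) * monomial Z \<alpha>)"
    unfolding B(4) using A(1) B(1) by (intro sum.mono_neutral_cong_left) auto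
  ultimately have "r + s = (\<Sum>\<alpha>\<in>A \<union> B. e \<alpha> * monomial Z \<alpha>)"
    by (simp add: e_def distrib_right sum.distrib)
  moreover have "e \<alpha> \<in> F" for \<alpha>
    using A(3) B(3) F by (auto simp: e_def intro: subfield_add subfield_0)
  ultimately show ?thesis
    unfolding polynomial_values_def using A(1,2) B(1,2)
    by (intro CollectI exI[of _ "A \<union> B"] exI[of _ e]) auto
qed

lemma polynomial_values_monomial:
  "c \<in> F \<Longrightarrow> \<alpha> \<in> exponents Z \<Longrightarrow> c * monomial Z \<alpha> \<in> polynomial_values F Z"
  unfolding polynomial_values_def
  by (intro CollectI exI[of _ "{\<alpha>}"] exI[of _ "\<lambda>_. c"]) auto

lemma polynomial_values_sum:
  assumes F: "is_subfield F" and "\<And>i. i \<in> I \<Longrightarrow> f i \<in> polynomial_values F Z"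
  shows "sum f I \<in> polynomial_values F Z"
proof -
  have "0 \<in> polynomial_values F Z"
    using polynomial_values_monomial[OF subfield_0[OF F], of "\<lambda>_. 0"] by (simp add: exponents_def)
  then show ?thesis using assms(2)
    by (induction I rule: infinite_finite_induct) (auto intro: polynomial_values_add[OF F])
qed

lemma is_subring_polynomial_values:
  assumes F: "is_subfield F"
  shows "is_subring (polynomial_values F Z)"
  unfolding is_subring_def
proof (intro conjI ballI)
  show "0 \<in> polynomial_values F Z" using polynomial_values_sum[OF F, of "{}"] by simp
  show "1 \<in> polynomial_values F Z"
    using polynomial_values_monomial[OF subfield_1[OF F], of "\<lambda>_. 0" Z]
    by (simp add: monomial_def exponents_def)
  fix r assume "r \<in> polynomial_values F Z"
  then obtain A c where
    A: "finite A" "A \<subseteq> exponents Z" "\<And>\<alpha>. c \<alpha> \<in> F" "r = (\<Sum>\<alpha>\<in>A. c \<alpha> * monomial Z \<alpha>)"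
    by (auto simp: polynomial_values_def)
  have "(\<Sum>\<alpha>\<in>A. (- c \<alpha>) * monomial Z \<alpha>) \<in> polynomial_values F Z"
    using A F by (intro polynomial_values_sum polynomial_values_monomial) (auto intro: subfield_uminus)
  then show "- r \<in> polynomial_values F Z" by (simp add: A(4) sum_negf)
  fix s assume s: "s \<in> polynomial_values F Z"
  then show "r + s \<in> polynomial_values F Z"
    using polynomial_values_add[OF F] \<open>r \<in> _\<close> by blast
  from s obtain B d where
    B: "finite B" "B \<subseteq> exponents Z" "\<And>\<alpha>. d \<alpha> \<in> F" "s = (\<Sum>\<alpha>\<in>B. d \<alpha> * monomial Z \<alpha>)"
    by (auto simp: polynomial_values_def)
  have "r * s = (\<Sum>\<alpha>\<in>A. \<Sum>\<beta>\<in>B. (c \<alpha> * d \<beta>) * monomial Z (\<lambda>z. \<alpha> z + \<beta> z))"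
    by (simp add: A(4) B(4) sum_product monomial_add mult_ac)
  also have "\<dots> \<in> polynomial_values F Z"
    using A B F by (intro polynomial_values_sum polynomial_values_monomial)
      (auto simp: exponents_def intro: subfield_mult)
  finally show "r * s \<in> polynomial_values F Z" .
qed

lemma field_adjoin_subset_polynomial_fractions:
  assumes F: "is_subfield F" and Z: "finite Z"
  shows "field_adjoin F Z \<subseteq> fractions (polynomial_values F Z)"
proof (rule field_adjoin_least)
  note R = is_subring_polynomial_values[OF F, of Z]
  show "is_subfield (fractions (polynomial_values F Z))" by (rule is_subfield_fractions[OF R])
  have "x \<in> polynomial_values F Z" if "x \<in> F" for x
    using polynomial_values_monomial[OF that, of "\<lambda>_. 0" Z] by (simp add: monomial_def exponents_def)
  then show "F \<subseteq> fractions (polynomial_values F Z)" using subset_fractions[OF R] by blast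
  have "z \<in> polynomial_values F Z" if "z \<in> Z" for z
  proof -
    have "monomial Z (\<lambda>y. if y = z then 1 else 0) = z"
      using Z that by (subst monomial_remove[of Z z]) (auto simp: monomial_def)
    then show ?thesis
      using polynomial_values_monomial[OF subfield_1[OF F], of "\<lambda>y. if y = z then 1 else 0" Z] that
      by (auto simp: exponents_def)
  qed
  then show "Z \<subseteq> fractions (polynomial_values F Z)" using subset_fractions[OF R] by blast
qed

text \<open>Clearing denominators gives a polynomial relation of \<open>z\<close> over
  \<open>F[Z - {z}]\<close>; expanding its coefficients into monomials makes it a relation among all
  of \<open>Z\<close>.\<close>

lemma algebraic_relation_exists:
  assumes F: "is_subfield F" and Z: "finite Z" and z: "z \<in> Z"
    and alg: "z \<in> relative_algebraic_closure (field_adjoin F (Z - {z}))"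
  shows "\<exists>N. algebraic_relation F Z N"
proof -
  let ?W = "Z - {z}"
  have "z \<in> relative_algebraic_closure (fractions (polynomial_values F ?W))"
    using alg relative_algebraic_closure_mono[OF field_adjoin_subset_polynomial_fractions[OF F, of ?W]]
      Z by auto
  then obtain Q where Q: "Q \<noteq> 0" "poly_over (polynomial_values F ?W) Q" "poly Q z = 0"
    using algebraic_over_fractions[OF is_subring_polynomial_values[OF F]] by metis
  have coeffQ: "poly.coeff Q i \<in> polynomial_values F ?W" for i using Q(2) by (simp add: poly_over_def)
  have "\<exists>A c. finite A \<and> A \<subseteq> exponents ?W \<and> (\<forall>\<alpha>. c \<alpha> \<in> F) \<and>
      poly.coeff Q i = (\<Sum>\<alpha>\<in>A. c \<alpha> * monomial ?W \<alpha>)" for i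
    using polynomial_valuesE[OF coeffQ[of i]] by metis
  then obtain A c where A: "\<And>i. finite (A i)" "\<And>i. A i \<subseteq> exponents ?W" "\<And>i \<alpha>. c i \<alpha> \<in> F"
    "\<And>i. poly.coeff Q i = (\<Sum>\<alpha>\<in>A i. c i \<alpha> * monomial ?W \<alpha>)" by metis
  define n where "n = Polynomial.degree Q"
  define S where "S = Sigma {..n} A"
  \<comment> \<open>\<open>g\<close> inserts the power of \<open>z\<close> into an exponent on
    \<open>Z - {z}\<close>; \<open>d\<close> recovers both parts to look up the coefficient.\<close>
  define g where "g = (\<lambda>(i, \<alpha>). \<alpha>(z := i :: nat))"
  define d where "d \<beta> = c (\<beta> z) (\<beta>(z := 0))" for \<beta>
  have S: "finite S" using A(1) by (auto simp: S_def)
  have restrict: "(\<alpha>(z := i))(z := 0) = \<alpha>" if "\<alpha> \<in> A j" for \<alpha> i j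
  proof -
    have "\<alpha> z = 0" using that A(2)[of j] by (auto simp: exponents_def)
    then show ?thesis by (simp add: fun_upd_idem)
  qed
  have inj: "inj_on g S"
  proof (rule inj_onI)
    fix u v assume uv: "u \<in> S" "v \<in> S" "g u = g v"
    obtain i \<alpha> j \<beta> where e: "u = (i, \<alpha>)" "v = (j, \<beta>)" by fastforce
    then have "\<alpha>(z := i) = \<beta>(z := j)" using uv(3) by (simp add: g_def)
    moreover from this have "i = j" by (metis fun_upd_same)
    moreover have "(\<alpha>(z := i))(z := 0) = \<alpha>" "(\<beta>(z := j))(z := 0) = \<beta>"
      using uv e restrict by (auto simp: S_def)
    ultimately show "u = v" using e by metis
  qed
  have "(\<Sum>\<beta>\<in>g ` S. d \<beta> * monomial Z \<beta>) = (\<Sum>(i, \<alpha>)\<in>S. c i \<alpha> * monomial ?W \<alpha> * z ^ i)"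
  proof (subst sum.reindex[OF inj], rule sum.cong)
    fix u assume "u \<in> S"
    then obtain i \<alpha> where u: "u = (i, \<alpha>)" "i \<le> n" "\<alpha> \<in> A i" by (auto simp: S_def)
    have "monomial ?W (\<alpha>(z := i)) = monomial ?W \<alpha>" by (rule monomial_cong) auto
    then show "((\<lambda>\<beta>. d \<beta> * monomial Z \<beta>) \<circ> g) u
        = (case u of (i, \<alpha>) \<Rightarrow> c i \<alpha> * monomial ?W \<alpha> * z ^ i)"
      using u restrict[OF u(3)] by (simp add: g_def d_def monomial_remove[OF Z z])
  qed simp
  also have "\<dots> = (\<Sum>i\<le>n. \<Sum>\<alpha>\<in>A i. c i \<alpha> * monomial ?W \<alpha> * z ^ i)"
    unfolding S_def using A(1) by (subst sum.Sigma) auto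
  also have "\<dots> = poly Q z" by (simp add: poly_altdef A(4) n_def sum_distrib_right)
  finally have "(\<Sum>\<beta>\<in>g ` S. d \<beta> * monomial Z \<beta>) = 0" using Q(3) by simp
  moreover have "\<exists>\<beta>\<in>g ` S. d \<beta> \<noteq> 0"
  proof -
    \<comment> \<open>Nontriviality survives the expansion because the leading coefficient of
      \<open>Q\<close> is not zero.\<close>
    have "poly.coeff Q n \<noteq> 0" using Q(1) by (simp add: n_def)
    then have "\<exists>\<alpha>\<in>A n. c n \<alpha> * monomial ?W \<alpha> \<noteq> 0"
      unfolding A(4) by (rule contrapos_np) (auto intro: sum.neutral)
    then obtain \<alpha> where \<alpha>: "\<alpha> \<in> A n" "c n \<alpha> \<noteq> 0" by auto
    then have "d (g (n, \<alpha>)) \<noteq> 0" using restrict[OF \<alpha>(1)] by (simp add: g_def d_def)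
    then show ?thesis using \<alpha> by (intro bexI[of _ "g (n, \<alpha>)"]) (auto simp: S_def)
  qed
  moreover have "g ` S \<subseteq> exponents Z"
    using A(2) z by (fastforce simp: g_def S_def exponents_def)
  moreover have "d \<beta> \<in> F" for \<beta> using A(3) by (simp add: d_def)
  moreover have "\<forall>\<beta>\<in>g ` S. sum \<beta> Z \<le> Max ((\<lambda>\<beta>. sum \<beta> Z) ` g ` S)"
    using S by (intro ballI Max_ge) auto
  ultimately show ?thesis
    unfolding algebraic_relation_def using S
    by (intro exI[of _ "Max ((\<lambda>\<beta>. sum \<beta> Z) ` g ` S)"] exI[of _ "g ` S"] exI[of _ d]) auto
qed

text \<open>Otherwise all exponents that occur are divisible by \<open>p\<close>, and every monomial
  is a \<open>p\<close>-th power. By minimality of \<open>N\<close> the \<open>p\<close>-th roots of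
  the monomials are independent over \<open>F\<close>, and the MacLane property makes the relation
  trivial.\<close>

lemma minimal_relation_has_nonzero_derivative:
  fixes F :: "'a::field set"
  assumes F: "is_subfield F" and ml: "mac_lane F" and Z: "finite Z"
    and A: "finite A" "A \<subseteq> exponents Z" "\<And>\<alpha>. \<alpha> \<in> A \<Longrightarrow> sum \<alpha> Z \<le> N" "\<And>\<alpha>. \<alpha> \<in> A \<Longrightarrow> c \<alpha> \<in> F"
      "(\<Sum>\<alpha>\<in>A. c \<alpha> * monomial Z \<alpha>) = 0" "\<exists>\<alpha>\<in>A. c \<alpha> \<noteq> 0"
    and min: "\<And>n. n < N \<Longrightarrow> \<not> algebraic_relation F Z n"
  shows "\<exists>\<alpha>\<in>A. \<exists>z\<in>Z. c \<alpha> \<noteq> 0 \<and> of_nat (\<alpha> z) \<noteq> (0::'a)"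
proof (rule ccontr)
  assume contra: "\<not> ?thesis"
  let ?p = "char_exponent TYPE('a)"
  define B where "B = {\<alpha>\<in>A. c \<alpha> \<noteq> 0}"
  have B: "finite B" "B \<noteq> {}" "B \<subseteq> exponents Z" using A by (auto simp: B_def)
  have sumB: "(\<Sum>\<alpha>\<in>B. c \<alpha> * monomial Z \<alpha>) = 0"
    using A(5) unfolding B_def by (subst (asm) sum.mono_neutral_right[of A B]) (use A(1) in \<open>auto simp: B_def\<close>)
  have div: "CHAR('a) dvd \<alpha> z" if "\<alpha> \<in> B" "z \<in> Z" for \<alpha> z
    using contra that by (auto simp: B_def of_nat_eq_0_iff_char_dvd)
  have nonconst: "\<exists>\<alpha>\<in>B. sum \<alpha> Z \<noteq> 0"
  proof (rule ccontr)
    assume "\<not> ?thesis"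
    then have "\<alpha> = (\<lambda>_. 0)" if "\<alpha> \<in> B" for \<alpha>
      using that B(3) Z by (fastforce simp: exponents_def)
    then have "B = {\<lambda>_. 0}" using B(2) by auto
    then have "c (\<lambda>_. 0) = 0" "(\<lambda>_. 0) \<in> B" using sumB by (auto simp: monomial_def)
    then show False by (simp add: B_def)
  qed
  \<comment> \<open>In characteristic zero, divisibility by the characteristic means being zero,
    which leaves only the constant monomial.\<close>
  have "CHAR('a) \<noteq> 0"
  proof
    assume "CHAR('a) = 0"
    then have "sum \<alpha> Z = 0" if "\<alpha> \<in> B" for \<alpha> using div[OF that] by simp
    then show False using nonconst by auto
  qed
  then have p: "?p = CHAR('a)" "?p > 1"
    using prime_CHAR_semidom[where 'a = 'a] by (auto simp: char_exponent_def prime_gt_Suc_0_nat)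
  define \<beta> where "\<beta> \<alpha> z = (\<alpha> z :: nat) div ?p" for \<alpha> and z :: 'a
  have \<alpha>\<beta>: "\<alpha> = (\<lambda>z. ?p * \<beta> \<alpha> z)" if "\<alpha> \<in> B" for \<alpha>
  proof
    fix z show "\<alpha> z = ?p * \<beta> \<alpha> z"
      using div[OF that, of z] that B(3) p(1) by (cases "z \<in> Z") (auto simp: \<beta>_def exponents_def)
  qed
  have mon: "monomial Z \<alpha> = monomial Z (\<beta> \<alpha>) ^ ?p" if "\<alpha> \<in> B" for \<alpha>
    using \<alpha>\<beta>[OF that] monomial_power by metis
  have inj\<beta>: "inj_on \<beta> B" using \<alpha>\<beta> by (metis inj_onI)
  have \<beta>ex: "\<beta> ` B \<subseteq> exponents Z" using B(3) by (auto simp: \<beta>_def exponents_def)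
  have N: "N > 0" using nonconst A(3) unfolding B_def by (metis (no_types, lifting) le_zero_eq mem_Collect_eq neq0_conv)
  have deg: "sum (\<beta> \<alpha>) Z \<le> N - 1" if "\<alpha> \<in> B" for \<alpha>
  proof -
    have "?p * sum (\<beta> \<alpha>) Z = sum \<alpha> Z" using arg_cong[OF \<alpha>\<beta>[OF that], of "\<lambda>f. sum f Z"] by (simp flip: sum_distrib_left)
    also have "\<dots> \<le> N" using that A(3) by (simp add: B_def)
    finally have le: "?p * sum (\<beta> \<alpha>) Z \<le> N" .
    \<comment> \<open>As \<open>p\<close> is at least \<open>2\<close>, passing to roots at least
      halves the degree; with \<open>N > 0\<close> this gives a strict decrease.\<close>
    have "2 * sum (\<beta> \<alpha>) Z \<le> ?p * sum (\<beta> \<alpha>) Z" using p(2) by (intro mult_le_mono1) simp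
    then show ?thesis using le N by linarith
  qed
  have norel: "d \<gamma> = 0" if "\<gamma> \<in> \<beta> ` B" "\<forall>\<gamma>\<in>\<beta> ` B. d \<gamma> \<in> F"
    "(\<Sum>\<gamma>\<in>\<beta> ` B. d \<gamma> * monomial Z \<gamma>) = 0" for d \<gamma>
  proof (rule ccontr)
    assume "d \<gamma> \<noteq> 0"
    then have "algebraic_relation F Z (N - 1)"
      unfolding algebraic_relation_def using that B(1) \<beta>ex deg
      by (intro exI[of _ "\<beta> ` B"] exI[of _ d]) auto
    then show False using min N by simp
  qed
  \<comment> \<open>The MacLane property speaks of elements, so different exponents must give
    different elements. A coincidence would be a relation, with coefficients \<open>1\<close> and
    \<open>- 1\<close>, of too small a degree.\<close>
  have inj: "inj_on (monomial Z) (\<beta> ` B)"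
  proof (rule inj_onI, rule ccontr)
    fix \<gamma> \<delta> assume h: "\<gamma> \<in> \<beta> ` B" "\<delta> \<in> \<beta> ` B" "monomial Z \<gamma> = monomial Z \<delta>" "\<gamma> \<noteq> \<delta>"
    define d :: "('a \<Rightarrow> nat) \<Rightarrow> 'a" where "d = (\<lambda>\<epsilon>. if \<epsilon> = \<gamma> then 1 else if \<epsilon> = \<delta> then - 1 else 0)"
    have "(\<Sum>\<epsilon>\<in>\<beta> ` B. d \<epsilon> * monomial Z \<epsilon>) = (\<Sum>\<epsilon>\<in>{\<gamma>, \<delta>}. d \<epsilon> * monomial Z \<epsilon>)"
      using h B(1) by (intro sum.mono_neutral_right) (auto simp: d_def)
    also have "\<dots> = 0" using h by (simp add: d_def)
    finally have "(\<Sum>\<epsilon>\<in>\<beta> ` B. d \<epsilon> * monomial Z \<epsilon>) = 0" .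
    moreover have "d \<epsilon> \<in> F" for \<epsilon>
      using F by (auto simp: d_def intro: subfield_0 subfield_1 subfield_uminus)
    ultimately have "d \<gamma> = 0" using norel[OF h(1), of d] by blast
    then show False by (simp add: d_def)
  qed
  define T where "T = monomial Z ` \<beta> ` B"
  have T: "finite T" using B(1) by (simp add: T_def)
  have "linearly_independent_over F T"
    unfolding linearly_independent_over_finite[OF subfield_0[OF F] T]
  proof (intro allI impI)
    fix d assume d: "(\<forall>w\<in>T. d w \<in> F) \<and> (\<Sum>w\<in>T. d w * w) = 0"
    then have "(\<Sum>\<gamma>\<in>\<beta> ` B. d (monomial Z \<gamma>) * monomial Z \<gamma>) = 0"
      unfolding T_def sum.reindex[OF inj] by (simp add: o_def)
    then have "d (monomial Z \<gamma>) = 0" if "\<gamma> \<in> \<beta> ` B" for \<gamma>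
      using norel[OF that, of "\<lambda>\<gamma>. d (monomial Z \<gamma>)"] d by (auto simp: T_def)
    then show "\<forall>w\<in>T. d w = 0" by (auto simp: T_def)
  qed
  moreover define g where "g = monomial Z \<circ> \<beta>"
  define e where "e = c \<circ> inv_into B g"
  have injg: "inj_on g B" using inj inj\<beta> by (simp add: g_def comp_inj_on)
  have Tg: "T = g ` B" by (simp add: T_def g_def image_image)
  have eg: "e (g \<alpha>) = c \<alpha>" if "\<alpha> \<in> B" for \<alpha> using that injg by (simp add: e_def)
  have "(\<Sum>t\<in>T. e t * t ^ ?p) = (\<Sum>\<alpha>\<in>B. c \<alpha> * monomial Z \<alpha>)"
    unfolding Tg sum.reindex[OF injg]
    by (rule sum.cong) (use mon in \<open>simp_all only: o_apply eg, simp add: g_def\<close>)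
  then have "(\<Sum>t\<in>T. e t * t ^ ?p) = 0" using sumB by simp
  moreover have "\<forall>t\<in>T. e t \<in> F" using eg A(4) by (auto simp: Tg B_def)
  ultimately have "\<forall>t\<in>T. e t = 0" using ml T unfolding mac_lane_def by blast
  then have "c \<alpha> = 0" if "\<alpha> \<in> B" for \<alpha> using eg[OF that] that by (auto simp: Tg)
  then show False using B(2) by (auto simp: B_def)
qed

section \<open>Simple roots\<close>

text \<open>\<open>P\<close> may be any polynomial over \<open>E\<close>, which makes the condition
  stable under enlarging \<open>E\<close>.\<close>

definition simple_root :: "'a::field set \<Rightarrow> 'a \<Rightarrow> bool" where
  "simple_root E z \<longleftrightarrow> (\<exists>P. poly_over E P \<and> poly P z = 0 \<and> poly (pderiv P) z \<noteq> 0)"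

lemma simple_root_mono: "simple_root E z \<Longrightarrow> E \<subseteq> M \<Longrightarrow> simple_root M z"
  unfolding simple_root_def using poly_over_mono by blast

lemma simple_root_algebraic: "simple_root E z \<Longrightarrow> z \<in> relative_algebraic_closure E"
  unfolding simple_root_def relative_algebraic_closure_iff by (metis pderiv_0 poly_0)

text \<open>In a relation of least total degree some variable \<open>y\<close> survives formal
  differentiation. The derivative has smaller degree, so by minimality it cannot vanish at the given
  elements, and the relation read as a polynomial in \<open>y\<close> has \<open>y\<close> as a
  simple root. This \<open>y\<close> may differ from \<open>z\<close>.\<close>

lemma dependent_imp_simple_root:
  fixes F :: "'a::field set"
  assumes F: "is_subfield F" and ml: "mac_lane F" and Z: "finite Z" and "z \<in> Z"
    and alg: "z \<in> relative_algebraic_closure (field_adjoin F (Z - {z}))"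
  shows "\<exists>y\<in>Z. simple_root (field_adjoin F (Z - {y})) y"
proof -
  define N where "N = (LEAST N. algebraic_relation F Z N)"
  have rel: "algebraic_relation F Z N"
    unfolding N_def using algebraic_relation_exists[OF F Z \<open>z \<in> Z\<close> alg] by (rule LeastI_ex)
  have min: "\<not> algebraic_relation F Z n" if "n < N" for n
    using that unfolding N_def by (rule not_less_Least)
  from rel obtain A c where A: "finite A" "A \<subseteq> exponents Z" "\<forall>\<alpha>\<in>A. sum \<alpha> Z \<le> N" "\<forall>\<alpha>\<in>A. c \<alpha> \<in> F"
    "(\<Sum>\<alpha>\<in>A. c \<alpha> * monomial Z \<alpha>) = 0" "\<exists>\<alpha>\<in>A. c \<alpha> \<noteq> 0"
    unfolding algebraic_relation_def by blast
  obtain \<alpha>0 y where \<alpha>0: "\<alpha>0 \<in> A" "c \<alpha>0 \<noteq> 0" "of_nat (\<alpha>0 y) \<noteq> (0::'a)" and y: "y \<in> Z"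
    using minimal_relation_has_nonzero_derivative[OF F ml Z A(1,2) _ _ A(5,6) min] A(3,4) by blast
  let ?E = "field_adjoin F (Z - {y})"
  define P where "P = (\<Sum>\<alpha>\<in>A. Polynomial.monom (c \<alpha> * monomial (Z - {y}) \<alpha>) (\<alpha> y))"
  have "monomial (Z - {y}) \<alpha> \<in> ?E" for \<alpha>
    by (rule monomial_mem[OF is_subfield_field_adjoin field_adjoin_gen])
  then have "poly_over ?E P"
    unfolding P_def using A(4) field_adjoin_base[of F]
    by (intro poly_over_sum poly_over_monom is_subfield_imp_subring is_subfield_field_adjoin
        subfield_mult) auto
  moreover have "poly P y = 0"
    using A(5) by (simp add: P_def poly_sum poly_monom monomial_remove[OF Z y] mult_ac)
  moreover have "poly (pderiv P) y \<noteq> 0"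
  proof
    assume zero: "poly (pderiv P) y = 0"
    \<comment> \<open>Exponents free of \<open>y\<close> are discarded: truncated subtraction would
      leave them fixed under \<open>g\<close>, and injectivity could fail.\<close>
    define B where "B = {\<alpha>\<in>A. \<alpha> y \<noteq> 0}"
    define g where "g \<alpha> = \<alpha>(y := \<alpha> y - 1 :: nat)" for \<alpha> :: "'a \<Rightarrow> nat"
    define d where "d \<beta> = of_nat (Suc (\<beta> y)) * c (\<beta>(y := Suc (\<beta> y)))" for \<beta>
    have unshift: "(g \<alpha>)(y := Suc (g \<alpha> y)) = \<alpha>" "Suc (g \<alpha> y) = \<alpha> y" if "\<alpha> \<in> B" for \<alpha>
      using that by (auto simp: g_def B_def)
    have inj: "inj_on g B" using unshift by (metis inj_onI)
    have B: "finite B" using A(1) by (simp add: B_def)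
    have "pderiv P = (\<Sum>\<alpha>\<in>A. pderiv (Polynomial.monom (c \<alpha> * monomial (Z - {y}) \<alpha>) (\<alpha> y)))"
      unfolding P_def by (induction A rule: infinite_finite_induct) (simp_all add: pderiv_add)
    then have "poly (pderiv P) y
        = (\<Sum>\<alpha>\<in>A. of_nat (\<alpha> y) * c \<alpha> * monomial (Z - {y}) \<alpha> * y ^ (\<alpha> y - 1))"
      by (simp add: poly_sum pderiv_monom poly_monom mult_ac)
    also have "\<dots> = (\<Sum>\<alpha>\<in>B. of_nat (\<alpha> y) * c \<alpha> * monomial (Z - {y}) \<alpha> * y ^ (\<alpha> y - 1))"
      using A(1) by (intro sum.mono_neutral_right) (auto simp: B_def)
    also have "\<dots> = (\<Sum>\<beta>\<in>g ` B. d \<beta> * monomial Z \<beta>)"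
    proof (subst sum.reindex[OF inj], rule sum.cong)
      fix \<alpha> assume \<alpha>: "\<alpha> \<in> B"
      have "monomial (Z - {y}) (g \<alpha>) = monomial (Z - {y}) \<alpha>" by (rule monomial_cong) (auto simp: g_def)
      moreover have "d (g \<alpha>) = of_nat (\<alpha> y) * c \<alpha>" using unshift[OF \<alpha>] by (simp only: d_def)
      moreover have "g \<alpha> y = \<alpha> y - 1" by (simp add: g_def)
      ultimately show "of_nat (\<alpha> y) * c \<alpha> * monomial (Z - {y}) \<alpha> * y ^ (\<alpha> y - 1)
          = ((\<lambda>\<beta>. d \<beta> * monomial Z \<beta>) \<circ> g) \<alpha>"
        by (simp add: monomial_remove[OF Z y] mult_ac)
    qed simp
    finally have sum: "(\<Sum>\<beta>\<in>g ` B. d \<beta> * monomial Z \<beta>) = 0" using zero by simp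
    have deg: "sum (g \<alpha>) Z \<le> N - 1" if "\<alpha> \<in> B" for \<alpha>
    proof -
      have "sum \<alpha> Z = \<alpha> y + sum \<alpha> (Z - {y})" "sum (g \<alpha>) Z = g \<alpha> y + sum (g \<alpha>) (Z - {y})"
        using Z y by (auto simp: sum.remove)
      moreover have "sum (g \<alpha>) (Z - {y}) = sum \<alpha> (Z - {y})" by (rule sum.cong) (auto simp: g_def)
      moreover have "sum \<alpha> Z \<le> N" using that A(3) by (auto simp: B_def)
      ultimately show ?thesis using unshift(2)[OF that] by linarith
    qed
    have \<alpha>B: "\<alpha>0 \<in> B" using \<alpha>0 by (auto simp: B_def intro: gr0I)
    have dg: "d (g \<alpha>) = of_nat (\<alpha> y) * c \<alpha>" if "\<alpha> \<in> B" for \<alpha>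
      using unshift[OF that] by (simp only: d_def)
    have "d (g \<alpha>0) \<noteq> 0" using dg[OF \<alpha>B] \<alpha>0 by simp
    moreover have "d (g \<alpha>) \<in> F" if "\<alpha> \<in> B" for \<alpha>
      unfolding dg[OF that] using that A(4) F
      by (auto simp: B_def intro!: subfield_mult subfield_of_nat)
    moreover have "g ` B \<subseteq> exponents Z" using A(2) y by (auto simp: B_def g_def exponents_def)
    ultimately have "algebraic_relation F Z (N - 1)"
      unfolding algebraic_relation_def using B sum deg \<alpha>B
      by (intro exI[of _ "g ` B"] exI[of _ d]) auto
    \<comment> \<open>This gives \<open>N > 0\<close>, without which \<open>N - 1\<close> would not
      be strictly smaller than \<open>N\<close>.\<close>
    moreover have "\<alpha>0 y \<le> sum \<alpha>0 Z" using Z y by (intro member_le_sum) auto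
    then have "0 < N" using A(3) \<alpha>0(1) \<alpha>B by (fastforce simp: B_def)
    ultimately show False using min[of "N - 1"] by simp
  qed
  ultimately show ?thesis using y unfolding simple_root_def by blast
qed

subsection \<open>Separable towers\<close>

inductive separable_tower :: "'a::field set \<Rightarrow> 'a set \<Rightarrow> bool" for L where
  base: "separable_tower L L"
| step: "separable_tower L M \<Longrightarrow> simple_root M z \<Longrightarrow> separable_tower L (field_adjoin M {z})"

lemma separable_tower_subfield: "separable_tower L M \<Longrightarrow> is_subfield L \<Longrightarrow> is_subfield M"
  by (induction rule: separable_tower.induct) (auto intro: is_subfield_field_adjoin)

lemma separable_tower_subset: "separable_tower L M \<Longrightarrow> L \<subseteq> M"
  by (induction rule: separable_tower.induct) (use field_adjoin_base in fastforce)+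

lemma separable_tower_finite_dim:
  assumes L: "is_subfield L" and "separable_tower L M"
  shows "finite_dim L M"
  using assms(2)
proof (induction rule: separable_tower.induct)
  case base
  show ?case by (rule finite_dim_refl[OF L])
next
  case (step M z)
  then show ?case
    by (intro finite_dim_adjoin L separable_tower_subfield[OF _ L] simple_root_algebraic)
qed

text \<open>While the elements are dependent, some \<open>y\<close> is a simple root over the field
  generated by the others. It remains one over any tower that contains the others, so it can be
  adjoined on top.\<close>

lemma separating_transcendence_basis:
  assumes F: "is_subfield F" and ml: "mac_lane F" and "finite Z"
  shows "\<exists>T M. T \<subseteq> Z \<and> (\<forall>t\<in>T. t \<notin> relative_algebraic_closure (field_adjoin F (T - {t}))) \<and>
           separable_tower (field_adjoin F T) M \<and> Z \<subseteq> M"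
  using assms(3)
proof (induction Z rule: finite_psubset_induct)
  case (psubset Z)
  show ?case
  proof (cases "\<exists>t\<in>Z. t \<in> relative_algebraic_closure (field_adjoin F (Z - {t}))")
    case False
    then show ?thesis using field_adjoin_gen[of Z F]
      by (intro exI[of _ Z] exI[of _ "field_adjoin F Z"]) (auto intro: separable_tower.base)
  next
    case True
    then obtain y where y: "y \<in> Z" "simple_root (field_adjoin F (Z - {y})) y"
      using dependent_imp_simple_root[OF F ml psubset.hyps(1)] by blast
    have "Z - {y} \<subset> Z" using y(1) by auto
    then obtain T M where T: "T \<subseteq> Z - {y}" "\<forall>t\<in>T. t \<notin> relative_algebraic_closure (field_adjoin F (T - {t}))"
      "separable_tower (field_adjoin F T) M" "Z - {y} \<subseteq> M"
      using psubset.IH by meson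
    have M: "is_subfield M" by (rule separable_tower_subfield[OF T(3) is_subfield_field_adjoin])
    have "F \<subseteq> M" using separable_tower_subset[OF T(3)] field_adjoin_base[of F T] by blast
    then have "simple_root M y"
      by (intro simple_root_mono[OF y(2)] field_adjoin_least M T(4))
    then have "separable_tower (field_adjoin F T) (field_adjoin M {y})"
      by (rule separable_tower.step[OF T(3)])
    moreover have "Z \<subseteq> field_adjoin M {y}"
      using T(4) field_adjoin_base[of M "{y}"] field_adjoin_gen[of "{y}" M] by auto
    ultimately show ?thesis using T(1,2) by blast
  qed
qed

text \<open>Over a maximal part \<open>S\<close> of the transcendence basis \<open>T\<close> that
  keeps \<open>x\<close> transcendental, every remaining \<open>t\<close> in \<open>T\<close> can be
  exchanged for \<open>x\<close>.\<close>

lemma separating_parameter: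
  assumes F: "is_subfield F" and ml: "mac_lane F" and Z: "finite Z" "x \<in> Z"
    and x: "x \<notin> relative_algebraic_closure F"
  obtains D t M where "is_subfield D" "F \<subseteq> D" "t \<notin> relative_algebraic_closure D"
    "t \<in> relative_algebraic_closure (field_adjoin D {x})"
    "separable_tower (field_adjoin D {t}) M" "Z \<subseteq> M"
proof -
  obtain T M where T: "T \<subseteq> Z" "\<forall>t\<in>T. t \<notin> relative_algebraic_closure (field_adjoin F (T - {t}))"
    "separable_tower (field_adjoin F T) M" "Z \<subseteq> M"
    using separating_transcendence_basis[OF F ml Z(1)] by meson
  have xT: "x \<in> relative_algebraic_closure (field_adjoin F T)"
    using T(3,4) Z(2)
    by (intro finite_dim_algebraic[of _ M] separable_tower_finite_dim separable_tower_subfield[OF T(3)]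
        is_subfield_field_adjoin) auto
  let ?S = "{S. S \<subseteq> T \<and> x \<notin> relative_algebraic_closure (field_adjoin F S)}"
  have "field_adjoin F {} = F" using field_adjoin_least[OF F, of F "{}"] field_adjoin_base[of F "{}"] by auto
  then have S: "finite ?S" "{} \<in> ?S" using x Z(1) T(1) finite_subset[of T Z] by auto
  obtain S where S: "S \<in> ?S" "\<forall>V\<in>?S. S \<subseteq> V \<longrightarrow> S = V"
    using finite_has_maximal2[OF S] by (elim bexE conjE)
  then have "S \<noteq> T" "S \<subseteq> T" using xT by auto
  then obtain t where t: "t \<in> T" "t \<notin> S" by blast
  have "insert t S \<notin> ?S" using S(2) t(2) by blast
  then have "x \<in> relative_algebraic_closure (field_adjoin (field_adjoin F S) {t})"
    using S(1) t(1) by (simp add: field_adjoin_adjoin)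
  then have "t \<in> relative_algebraic_closure (field_adjoin (field_adjoin F S) {x})"
    using algebraic_exchange[OF is_subfield_field_adjoin, of x F S t] S(1) by blast
  \<comment> \<open>Enlarging \<open>S\<close> to \<open>T - {t}\<close> makes \<open>D(t)\<close>
    the base field of the tower; \<open>t\<close> is transcendental over \<open>D\<close> by
    independence of \<open>T\<close>.\<close>
  moreover have "field_adjoin (field_adjoin F S) {x} \<subseteq> field_adjoin (field_adjoin F (T - {t})) {x}"
    using S(1) t(2) by (intro field_adjoin_mono) auto
  ultimately have "t \<in> relative_algebraic_closure (field_adjoin (field_adjoin F (T - {t})) {x})"
    using relative_algebraic_closure_mono by blast
  moreover have "T - {t} \<union> {t} = T" using t(1) by auto
  then have "separable_tower (field_adjoin (field_adjoin F (T - {t})) {t}) M"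
    using T(3) by (simp only: field_adjoin_adjoin)
  ultimately show ?thesis
    using that[OF is_subfield_field_adjoin field_adjoin_base] T(2,4) t(1) by blast
qed

subsection \<open>Field topologies\<close>

lemma field_topology_topspace: "field_topology \<tau> \<Longrightarrow> topspace \<tau> = UNIV"
  by (simp add: field_topology_def)

lemma limitin_field_add:
  assumes "field_topology \<tau>" "limitin \<tau> f a F" "limitin \<tau> g b F"
  shows "limitin \<tau> (\<lambda>t. f t + g t) (a + b) F"
proof -
  have "limitin (prod_topology \<tau> \<tau>) (\<lambda>t. (f t, g t)) (a, b) F"
    using assms(2,3) by (simp add: limitin_pairwise o_def)
  then show ?thesis
    using continuous_map_limit[of "prod_topology \<tau> \<tau>" \<tau> "\<lambda>(x, y). x + y"] assms(1)
    by (force simp: field_topology_def o_def)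
qed

lemma limitin_field_mult:
  assumes "field_topology \<tau>" "limitin \<tau> f a F" "limitin \<tau> g b F"
  shows "limitin \<tau> (\<lambda>t. f t * g t) (a * b) F"
proof -
  have "limitin (prod_topology \<tau> \<tau>) (\<lambda>t. (f t, g t)) (a, b) F"
    using assms(2,3) by (simp add: limitin_pairwise o_def)
  then show ?thesis
    using continuous_map_limit[of "prod_topology \<tau> \<tau>" \<tau> "\<lambda>(x, y). x * y"] assms(1)
    by (force simp: field_topology_def o_def)
qed

lemma limitin_field_inverse:
  assumes "field_topology \<tau>" "limitin \<tau> f a F" "a \<noteq> 0" "\<forall>\<^sub>F t in F. f t \<noteq> 0"
  shows "limitin \<tau> (\<lambda>t. inverse (f t)) (inverse a) F"
proof -
  have "limitin (subtopology \<tau> (- {0})) f a F"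
    using assms by (simp add: limitin_subtopology)
  then show ?thesis
    using continuous_map_limit[of "subtopology \<tau> (- {0})" \<tau> inverse] assms(1)
    by (force simp: field_topology_def o_def)
qed

lemma limitin_field_poly:
  assumes \<tau>: "field_topology \<tau>" and f: "limitin \<tau> f a F"
  shows "limitin \<tau> (\<lambda>t. poly q (f t)) (poly q a) F"
proof (induction q)
  case 0
  then show ?case using field_topology_topspace[OF \<tau>] by simp
next
  case (pCons c q)
  then show ?case
    using limitin_field_add[OF \<tau> _ limitin_field_mult[OF \<tau> f pCons.IH], of "\<lambda>_. c" c]
      field_topology_topspace[OF \<tau>] by simp
qed

lemma t1_space_V_topology:
  fixes \<tau> :: "'a::field topology"
  assumes "V_topology \<tau>"
  shows "t1_space \<tau>"
  unfolding t1_space_def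
proof (intro ballI impI)
  fix x s :: 'a assume "x \<noteq> s"
  have "openin \<tau> (- {s})"
  proof -
    consider v where "absolute_value v" "induced_by_absolute_value \<tau> v"
      | A where "valuation_ring A" "A \<noteq> UNIV" "induced_by_valuation_ring \<tau> A"
      using assms unfolding V_topology_def by blast
    then show ?thesis
    proof cases
      case (1 v)
      have "\<exists>\<epsilon>>0. \<forall>y. v (y - x) < \<epsilon> \<longrightarrow> y \<in> - {s}" if "x \<in> - {s}" for x
      \<comment> \<open>The radius is the distance from \<open>x\<close> to \<open>s\<close>; the
        strict inequality excludes \<open>s\<close>.\<close>
      proof (intro exI[of _ "v (s - x)"] conjI)
        have "v (s - x) \<noteq> 0" "0 \<le> v (s - x)" using 1 that by (auto simp: absolute_value_def)
        then show "0 < v (s - x)" by simp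
      qed auto
      then show ?thesis using 1 unfolding induced_by_absolute_value_def by blast
    next
      case (2 A)
      from 2(2) obtain c where c: "c \<notin> A" by auto
      have "\<exists>a. a \<noteq> 0 \<and> (\<forall>y. (y - x) / a \<in> A \<longrightarrow> y \<in> - {s})" if "x \<in> - {s}" for x
      \<comment> \<open>The scale is such that \<open>y = s\<close> would put the excluded element
        \<open>c\<close> into \<open>A\<close>.\<close>
      proof (intro exI[of _ "(s - x) / c"] conjI allI impI)
        have "c \<noteq> 0" using c 2 by (auto simp: valuation_ring_def)
        then show "(s - x) / c \<noteq> 0" using that by auto
        fix y assume "(y - x) / ((s - x) / c) \<in> A"
        then show "y \<in> - {s}" using c that by auto
      qed
      then show ?thesis using 2 unfolding induced_by_valuation_ring_def by blast
    qed
  qed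
  then show "\<exists>U. openin \<tau> U \<and> x \<in> U \<and> s \<notin> U"
    using \<open>x \<noteq> s\<close> by (intro exI[of _ "- {s}"]) auto
qed

lemma V_topology_not_discrete:
  fixes \<tau> :: "'a::field topology"
  assumes "V_topology \<tau>"
  shows "\<not> openin \<tau> {t}"
proof
  assume op: "openin \<tau> {t}"
  consider v where "absolute_value v" "\<exists>x. x \<noteq> 0 \<and> v x \<noteq> 1" "induced_by_absolute_value \<tau> v"
    | A where "valuation_ring A" "induced_by_valuation_ring \<tau> A"
    using assms unfolding V_topology_def by blast
  then show False
  proof cases
    case (1 v)
    have v: "v (x * y) = v x * v y" "v x = 0 \<longleftrightarrow> x = 0" "0 \<le> v x" for x y
      using 1(1) by (auto simp: absolute_value_def)
    have "v 1 * v 1 = v 1" "v 1 \<noteq> 0" using v(1)[of 1 1] v(2)[of 1] by auto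
    then have v1: "v 1 = 1" by (metis mult_cancel_left1)
    have pow: "v (x ^ n) = v x ^ n" for x n by (induction n) (auto simp: v1 v(1))
    from 1(2) obtain x where x: "x \<noteq> 0" "v x \<noteq> 1" by auto
    \<comment> \<open>Powers of such an element tend to \<open>0\<close>, so translates by them come
      arbitrarily close to \<open>t\<close>.\<close>
    have "\<exists>y. y \<noteq> 0 \<and> v y < 1"
    proof (cases "v x < 1")
      case False
      have "v x * v (inverse x) = 1" using v(1)[of x "inverse x"] x v1 by simp
      moreover have "v x > 1" using False x by simp
      ultimately have "v (inverse x) < 1" by (metis v(3) mult_le_cancel_left1 not_le order_less_le_trans less_le_not_le mult_1 mult_less_cancel_right2 zero_less_one)
      then show ?thesis using x by (intro exI[of _ "inverse x"]) auto
    qed (use x in auto)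
    then obtain y where y: "y \<noteq> 0" "v y < 1" by auto
    obtain \<epsilon> where \<epsilon>: "\<epsilon> > 0" "\<And>z. v (z - t) < \<epsilon> \<Longrightarrow> z = t"
      using 1(3) op unfolding induced_by_absolute_value_def by auto
    obtain n where "v y ^ n < \<epsilon>" using real_arch_pow_inv[OF \<epsilon>(1) y(2)] by auto
    then have "t + y ^ n = t" using \<epsilon>(2)[of "t + y ^ n"] by (simp add: pow)
    then show False using y(1) by simp
  next
    case (2 A)
    obtain a where a: "a \<noteq> 0" "\<And>y. (y - t) / a \<in> A \<Longrightarrow> y = t"
      using 2(2) op unfolding induced_by_valuation_ring_def by auto
    \<comment> \<open>The basic neighbourhood \<open>t + a A\<close> contains \<open>t + a\<close>
      because \<open>1 \<in> A\<close>.\<close>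
    have "t + a = t" using a(1) a(2)[of "t + a"] 2(1) by (auto simp: valuation_ring_def)
    then show False using a(1) by simp
  qed
qed

lemma V_topology_open_infinite:
  assumes V: "V_topology \<tau>" and U: "openin \<tau> U" "t \<in> U"
  shows "infinite U"
proof
  assume "finite U"
  then have "closedin \<tau> (U - {t})"
    using t1_space_V_topology[OF V] U(1) openin_subset unfolding t1_space_closedin_finite by blast
  then have "openin \<tau> (U - (U - {t}))" by (rule openin_diff[OF U(1)])
  moreover have "U - (U - {t}) = {t}" using U(2) by auto
  ultimately show False using V_topology_not_discrete[OF V] by simp
qed

lemma eventually_root_imp_zero_poly:
  assumes V: "V_topology \<tau>" and ev: "\<forall>\<^sub>F s in nhdsin \<tau> t. poly q s = 0"
  shows "q = 0"
proof (rule ccontr)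
  assume "q \<noteq> 0"
  have "t \<in> topspace \<tau>" using V by (simp add: V_topology_def field_topology_def)
  then obtain U where U: "openin \<tau> U" "t \<in> U" "\<forall>s\<in>U. poly q s = 0"
    using ev by (auto simp: eventually_nhdsin)
  then have "U \<subseteq> {s. poly q s = 0}" by auto
  then have "finite U" using poly_roots_finite[OF \<open>q \<noteq> 0\<close>] by (rule finite_subset)
  then show False using V_topology_open_infinite[OF V U(1,2)] by simp
qed

text \<open>Finite sets are closed in a T1 space. Applied to a finite set without the limit point,
  this turns convergence within a finite set into eventual equality.\<close>

lemma limitin_avoids_finite:
  assumes V: "V_topology \<tau>" and f: "limitin \<tau> f a F" and S: "finite S" "a \<notin> S"
  shows "\<forall>\<^sub>F t in F. f t \<notin> S"
proof -
  have top: "topspace \<tau> = UNIV" using V by (simp add: V_topology_def field_topology_def)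
  then have "closedin \<tau> S"
    using t1_space_V_topology[OF V] S(1) unfolding t1_space_closedin_finite by auto
  then have "openin \<tau> (- S)" using top by (metis Compl_eq_Diff_UNIV openin_closedin_eq openin_diff openin_topspace)
  then show ?thesis using f S(2) by (auto simp: limitin_def)
qed

subsection \<open>Continuity of simple roots\<close>

abbreviation indeterminate :: "nat \<Rightarrow> 'a::field mpoly" where
  "indeterminate i \<equiv> Poly_Mapping.single (Poly_Mapping.single i (Suc 0)) 1"

lemma mpoly_eval_0 [simp]: "mpoly_eval x 0 = 0"
  by (simp add: mpoly_eval_def)

lemma mpoly_eval_single [simp]:
  "mpoly_eval x (Poly_Mapping.single (Poly_Mapping.single i (Suc 0)) c) = c * x i"
  by (cases "c = 0") (auto simp: mpoly_eval_def)

text \<open>Such multiples arise as coefficients when \<open>pderiv\<close> is applied to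
  \<open>generic_poly\<close> below.\<close>

lemma of_nat_times_indeterminate:
  "of_nat n * indeterminate i = Poly_Mapping.single (Poly_Mapping.single i (Suc 0)) (of_nat n)"
proof (induction n)
  case (Suc n)
  then show ?case by (simp add: distrib_right single_add add.commute flip: Poly_Mapping.single_add)
qed simp

text \<open>The polynomial with indeterminate coefficients: through it the implicit function theorem
  describes a root as a function of the coefficients.\<close>

definition generic_poly :: "nat \<Rightarrow> 'a::field mpoly poly" where
  "generic_poly n = (\<Sum>i\<le>n. Polynomial.monom (indeterminate i) i)"

lemma coeff_generic_poly: "poly.coeff (generic_poly n) i = (if i \<le> n then indeterminate i else 0)"
  by (simp add: generic_poly_def coeff_sum)

lemma eval_at_generic_poly: "eval_at (generic_poly n) x y = (\<Sum>i\<le>n. x i * y ^ i)"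
proof -
  have "map_poly (mpoly_eval x) (generic_poly n) = (\<Sum>i\<le>n. Polynomial.monom (x i) i)"
    by (rule poly_eqI) (auto simp: coeff_map_poly coeff_generic_poly coeff_sum)
  then show ?thesis by (simp add: eval_at_def poly_sum poly_monom)
qed

lemma eval_at_pderiv_generic_poly:
  "eval_at (pderiv (generic_poly n)) x y = poly (pderiv (\<Sum>i\<le>n. Polynomial.monom (x i) i)) y"
proof -
  have "map_poly (mpoly_eval x) (pderiv (generic_poly n)) = pderiv (\<Sum>i\<le>n. Polynomial.monom (x i) i)"
    by (rule poly_eqI)
      (auto simp: coeff_map_poly coeff_pderiv coeff_generic_poly coeff_sum of_nat_times_indeterminate
        simp del: of_nat_Suc)
  then show ?thesis by (simp add: eval_at_def)
qed

text \<open>The implicit function for the generic polynomial, evaluated at the moving coefficients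
  \<open>c i t\<close>, follows the root that tends to \<open>z\<close>.\<close>

lemma simple_root_continuous:
  fixes \<tau> :: "'a::field topology"
  assumes top: "topspace \<tau> = UNIV" and ift: "polynomial_implicit_function_theorem \<tau>"
    and P: "poly P z = 0" "poly (pderiv P) z \<noteq> 0"
    and c: "\<And>i. limitin \<tau> (c i) (poly.coeff P i) F"
  obtains r where "limitin \<tau> r z F" "\<forall>\<^sub>F t in F. (\<Sum>i\<le>Polynomial.degree P. c i t * r t ^ i) = 0"
proof -
  define n where "n = Polynomial.degree P"
  define e where "e = restrict (poly.coeff P) {..<Suc n}"
  let ?T = "power_topology (Suc n) \<tau>"
  have P_eq: "(\<Sum>i\<le>n. Polynomial.monom (e i) i) = P"
    by (rule poly_eqI) (auto simp: coeff_sum e_def n_def coeff_eq_0)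
  have "mpoly_vars (poly.coeff (generic_poly n :: 'a mpoly poly) i) \<subseteq> {..<Suc n}" for i
    by (auto simp: coeff_generic_poly mpoly_vars_def)
  moreover have "e \<in> {..<Suc n} \<rightarrow>\<^sub>E UNIV" by (simp add: e_def)
  moreover have "eval_at (generic_poly n) e z = poly P z"
    by (subst P_eq[symmetric]) (simp add: eval_at_generic_poly poly_sum poly_monom)
  moreover have "eval_at (pderiv (generic_poly n)) e z = poly (pderiv P) z"
    by (simp add: eval_at_pderiv_generic_poly P_eq)
  ultimately have "\<exists>U V g. openin ?T U \<and> e \<in> U \<and> openin \<tau> V \<and> z \<in> V \<and>
      continuous_map (subtopology ?T U) (subtopology \<tau> V) g \<and>
      {(x, y). x \<in> U \<and> y \<in> V \<and> eval_at (generic_poly n) x y = 0} = {(x, g x) | x. x \<in> U}"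
    using P ift[unfolded polynomial_implicit_function_theorem_def, rule_format, of "generic_poly n" "Suc n" e z]
    by simp
  then obtain U V g where U: "openin ?T U" "e \<in> U" and V: "openin \<tau> V" "z \<in> V"
    and g: "continuous_map (subtopology ?T U) (subtopology \<tau> V) g"
    and graph: "{(x, y). x \<in> U \<and> y \<in> V \<and> eval_at (generic_poly n) x y = 0} = {(x, g x) | x. x \<in> U}"
    by blast
  \<comment> \<open>The point \<open>(e, z)\<close> lies on the graph, so the branch of roots
    described by \<open>g\<close> passes through \<open>z\<close>.\<close>
  have "(e, z) \<in> {(x, y). x \<in> U \<and> y \<in> V \<and> eval_at (generic_poly n) x y = 0}"
    using U V P \<open>eval_at (generic_poly n) e z = poly P z\<close> by simp
  then have gz: "g e = z" unfolding graph by auto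
  have root: "eval_at (generic_poly n) x (g x) = 0" if "x \<in> U" for x
  proof -
    have "(x, g x) \<in> {(x, y). x \<in> U \<and> y \<in> V \<and> eval_at (generic_poly n) x y = 0}"
      unfolding graph using that by auto
    then show ?thesis by simp
  qed
  define h where "h t = restrict (\<lambda>i. c i t) {..<Suc n}" for t
  have "limitin ?T h e F"
    unfolding limitin_componentwise using c top by (auto simp: h_def e_def PiE_iff)
  moreover have hU: "\<forall>\<^sub>F t in F. h t \<in> U" using calculation U by (simp add: limitin_def)
  ultimately have "limitin (subtopology ?T U) h e F" using U by (simp add: limitin_subtopology)
  then have "limitin (subtopology \<tau> V) (g \<circ> h) (g e) F" by (rule continuous_map_limit[OF g])
  then have "limitin \<tau> (g \<circ> h) z F" by (simp add: limitin_subtopology gz)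
  moreover have "\<forall>\<^sub>F t in F. (\<Sum>i\<le>n. c i t * (g \<circ> h) t ^ i) = 0"
    using hU
  proof eventually_elim
    case (elim t)
    have "(\<Sum>i\<le>n. c i t * (g \<circ> h) t ^ i) = (\<Sum>i\<le>n. h t i * g (h t) ^ i)"
      by (rule sum.cong) (auto simp: h_def)
    then show ?case using root[OF elim] by (simp add: eval_at_generic_poly)
  qed
  ultimately show ?thesis using that unfolding n_def by blast
qed

subsection \<open>Embeddings into rings of germs\<close>

text \<open>A homomorphism from \<open>M\<close> to the germs along \<open>F\<close>, given by representatives, that is a section
  of taking limits.\<close>

definition germ_hom :: "'a::field topology \<Rightarrow> 'b filter \<Rightarrow> 'a set \<Rightarrow> ('a \<Rightarrow> 'b \<Rightarrow> 'a) \<Rightarrow> bool" where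
  "germ_hom \<tau> F M \<sigma> \<longleftrightarrow> (\<forall>u\<in>M. limitin \<tau> (\<sigma> u) u F) \<and> (\<forall>t. \<sigma> 0 t = 0) \<and>
     (\<forall>\<^sub>F t in F. \<sigma> 1 t = 1) \<and>
     (\<forall>u\<in>M. \<forall>v\<in>M. \<forall>\<^sub>F t in F. \<sigma> (u + v) t = \<sigma> u t + \<sigma> v t) \<and>
     (\<forall>u\<in>M. \<forall>v\<in>M. \<forall>\<^sub>F t in F. \<sigma> (u * v) t = \<sigma> u t * \<sigma> v t)"

lemma germ_hom_uminus:
  assumes "germ_hom \<tau> F M \<sigma>" "is_subfield M" "u \<in> M"
  shows "\<forall>\<^sub>F t in F. \<sigma> (- u) t = - \<sigma> u t"
proof -
  have "\<forall>\<^sub>F t in F. \<sigma> (u + - u) t = \<sigma> u t + \<sigma> (- u) t"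
    using assms subfield_uminus[of M u] unfolding germ_hom_def by blast
  then show ?thesis
  proof eventually_elim
    case (elim t)
    then have "\<sigma> u t + \<sigma> (- u) t = 0" using assms(1) by (simp add: germ_hom_def)
    then show ?case by (simp add: add_eq_0_iff)
  qed
qed

lemma germ_hom_inverse:
  assumes "germ_hom \<tau> F M \<sigma>" "is_subfield M" "u \<in> M" "u \<noteq> 0"
  shows "\<forall>\<^sub>F t in F. \<sigma> (inverse u) t * \<sigma> u t = 1"
proof -
  have "\<forall>\<^sub>F t in F. \<sigma> (inverse u * u) t = \<sigma> (inverse u) t * \<sigma> u t"
    using assms subfield_inverse[of M u] unfolding germ_hom_def by blast
  moreover have "\<forall>\<^sub>F t in F. \<sigma> 1 t = 1" using assms(1) by (simp add: germ_hom_def)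
  ultimately show ?thesis by eventually_elim (use assms(4) in simp)
qed

text \<open>The germ of \<open>inverse u\<close> inverts the germ of \<open>u\<close>. This is what
  lets inequations persist near the base point.\<close>

lemma germ_hom_nonzero:
  assumes "germ_hom \<tau> F M \<sigma>" "is_subfield M" "u \<in> M" "u \<noteq> 0"
  shows "\<forall>\<^sub>F t in F. \<sigma> u t \<noteq> 0"
  using germ_hom_inverse[OF assms] by eventually_elim auto

definition germ_fixed :: "'a::field filter \<Rightarrow> 'a set \<Rightarrow> ('a \<Rightarrow> 'a \<Rightarrow> 'a) \<Rightarrow> 'a set" where
  "germ_fixed F M \<sigma> = {u\<in>M. \<forall>\<^sub>F t in F. \<sigma> u t = u}"

text \<open>The purpose is that once the germs of \<open>D\<close> and of \<open>x\<close> are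
  constant, so are those of \<open>D(x)\<close>.\<close>

lemma is_subfield_germ_fixed:
  assumes \<sigma>: "germ_hom \<tau> F M \<sigma>" and M: "is_subfield M"
  shows "is_subfield (germ_fixed F M \<sigma>)"
  unfolding is_subfield_def
proof (intro conjI ballI)
  show "0 \<in> germ_fixed F M \<sigma>" "1 \<in> germ_fixed F M \<sigma>"
    using \<sigma> M by (auto simp: germ_fixed_def germ_hom_def intro: subfield_0 subfield_1)
  fix u assume "u \<in> germ_fixed F M \<sigma>"
  then have u: "u \<in> M" "\<forall>\<^sub>F t in F. \<sigma> u t = u" by (auto simp: germ_fixed_def)
  have "\<forall>\<^sub>F t in F. \<sigma> (- u) t = - u"
    using u(2) germ_hom_uminus[OF \<sigma> M u(1)] by eventually_elim auto
  then show "- u \<in> germ_fixed F M \<sigma>" using u M by (simp add: germ_fixed_def subfield_uminus)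
  show "inverse u \<in> germ_fixed F M \<sigma>"
  proof (cases "u = 0")
    case True
    then show ?thesis using \<open>u \<in> germ_fixed F M \<sigma>\<close> by simp
  next
    case False
    have "\<forall>\<^sub>F t in F. \<sigma> (inverse u) t = inverse u"
      using u(2) germ_hom_inverse[OF \<sigma> M u(1) False]
      by eventually_elim (use False in \<open>simp add: field_simps\<close>)
    then show ?thesis using u M by (simp add: germ_fixed_def subfield_inverse)
  qed
  fix v assume "v \<in> germ_fixed F M \<sigma>"
  then have v: "v \<in> M" "\<forall>\<^sub>F t in F. \<sigma> v t = v" by (auto simp: germ_fixed_def)
  have "\<forall>\<^sub>F t in F. \<sigma> (u + v) t = \<sigma> u t + \<sigma> v t" "\<forall>\<^sub>F t in F. \<sigma> (u * v) t = \<sigma> u t * \<sigma> v t"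
    using \<sigma> u(1) v(1) by (auto simp: germ_hom_def)
  then have "\<forall>\<^sub>F t in F. \<sigma> (u + v) t = u + v" "\<forall>\<^sub>F t in F. \<sigma> (u * v) t = u * v"
    using u(2) v(2) by (eventually_elim, simp)+
  then show "u + v \<in> germ_fixed F M \<sigma>" "u * v \<in> germ_fixed F M \<sigma>"
    using u v M by (auto simp: germ_fixed_def intro: subfield_add subfield_mult)
qed

text \<open>The extension of \<open>\<sigma>\<close> to polynomials that sends the variable to
  \<open>r\<close>. For its coefficients to be computed at each single \<open>t\<close>,
  \<open>\<sigma> 0\<close> must vanish everywhere and not only eventually.\<close>

definition germ_eval :: "('a::field \<Rightarrow> 'b \<Rightarrow> 'a) \<Rightarrow> ('b \<Rightarrow> 'a) \<Rightarrow> 'a poly \<Rightarrow> 'b \<Rightarrow> 'a" where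
  "germ_eval \<sigma> r q t = poly (map_poly (\<lambda>a. \<sigma> a t) q) (r t)"

context
  fixes \<tau> :: "'a::field topology" and F :: "'b filter" and M \<sigma> r z
  assumes \<tau>: "field_topology \<tau>" and \<sigma>: "germ_hom \<tau> F M \<sigma>" and M: "is_subfield M"
    and r: "limitin \<tau> r z F"
begin

lemma germ_eval_0: "germ_eval \<sigma> r 0 t = 0"
  by (simp add: germ_eval_def)

lemma germ_eval_pCons: "germ_eval \<sigma> r (pCons a q) t = \<sigma> a t + r t * germ_eval \<sigma> r q t"
  using \<sigma> by (simp add: germ_eval_def germ_hom_def map_poly_pCons)

lemma germ_eval_sum:
  "germ_eval \<sigma> r q t = (\<Sum>i\<le>Polynomial.degree q. \<sigma> (poly.coeff q i) t * r t ^ i)"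
proof -
  have s0: "\<sigma> 0 t = 0" using \<sigma> by (simp add: germ_hom_def)
  have coeff: "poly.coeff (map_poly (\<lambda>a. \<sigma> a t) q) i = \<sigma> (poly.coeff q i) t" for i
    by (simp add: coeff_map_poly s0)
  have "Polynomial.degree (map_poly (\<lambda>a. \<sigma> a t) q) \<le> Polynomial.degree q" by (rule map_poly_degree_leq)
  then show ?thesis
    unfolding germ_eval_def poly_altdef
    by (intro sum.mono_neutral_cong_left) (auto simp: coeff_eq_0 simp flip: coeff)
qed

lemma germ_eval_limit: "poly_over M q \<Longrightarrow> limitin \<tau> (germ_eval \<sigma> r q) (poly q z) F"
proof (induction q)
  case 0
  then show ?case using field_topology_topspace[OF \<tau>] by (simp add: germ_eval_0)
next
  case (pCons a q)
  have "limitin \<tau> (\<sigma> a) a F" using pCons.prems \<sigma> by (simp add: germ_hom_def)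
  then show ?case
    using limitin_field_add[OF \<tau> _ limitin_field_mult[OF \<tau> r pCons.IH]] pCons.prems
    by (simp add: germ_eval_pCons)
qed

lemma germ_eval_add:
  "poly_over M p \<Longrightarrow> poly_over M q \<Longrightarrow>
   \<forall>\<^sub>F t in F. germ_eval \<sigma> r (p + q) t = germ_eval \<sigma> r p t + germ_eval \<sigma> r q t"
proof (induction p q rule: poly_induct2)
  case 0
  then show ?case by (simp add: germ_eval_0)
next
  case (pCons a p b q)
  then have "\<forall>\<^sub>F t in F. germ_eval \<sigma> r (p + q) t = germ_eval \<sigma> r p t + germ_eval \<sigma> r q t"
    "\<forall>\<^sub>F t in F. \<sigma> (a + b) t = \<sigma> a t + \<sigma> b t"
    using \<sigma> by (auto simp: germ_hom_def)
  then show ?case by eventually_elim (simp add: germ_eval_pCons algebra_simps)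
qed

lemma germ_eval_smult:
  "a \<in> M \<Longrightarrow> poly_over M q \<Longrightarrow>
   \<forall>\<^sub>F t in F. germ_eval \<sigma> r (smult a q) t = \<sigma> a t * germ_eval \<sigma> r q t"
proof (induction q)
  case 0
  then show ?case by (simp add: germ_eval_0)
next
  case (pCons b q)
  then have "\<forall>\<^sub>F t in F. germ_eval \<sigma> r (smult a q) t = \<sigma> a t * germ_eval \<sigma> r q t"
    "\<forall>\<^sub>F t in F. \<sigma> (a * b) t = \<sigma> a t * \<sigma> b t"
    using \<sigma> by (auto simp: germ_hom_def)
  then show ?case by eventually_elim (simp add: germ_eval_pCons algebra_simps)
qed

lemma germ_eval_mult:
  "poly_over M p \<Longrightarrow> poly_over M q \<Longrightarrow>
   \<forall>\<^sub>F t in F. germ_eval \<sigma> r (p * q) t = germ_eval \<sigma> r p t * germ_eval \<sigma> r q t"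
proof (induction p)
  case 0
  then show ?case by (simp add: germ_eval_0)
next
  case (pCons a p)
  note R = is_subfield_imp_subring[OF M]
  have "poly_over M (smult a q)" "poly_over M (pCons 0 (p * q))"
    using pCons.prems R M by (auto intro: poly_over_smult poly_over_mult subfield_0)
  then have "\<forall>\<^sub>F t in F. germ_eval \<sigma> r (smult a q + pCons 0 (p * q)) t
      = germ_eval \<sigma> r (smult a q) t + germ_eval \<sigma> r (pCons 0 (p * q)) t"
    by (rule germ_eval_add)
  moreover have "\<forall>\<^sub>F t in F. germ_eval \<sigma> r (smult a q) t = \<sigma> a t * germ_eval \<sigma> r q t"
    using pCons.prems by (intro germ_eval_smult) auto
  moreover have "\<forall>\<^sub>F t in F. germ_eval \<sigma> r (p * q) t = germ_eval \<sigma> r p t * germ_eval \<sigma> r q t"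
    using pCons by auto
  ultimately show ?case
  proof eventually_elim
    case (elim t)
    have "\<sigma> 0 t = 0" using \<sigma> by (simp add: germ_hom_def)
    then show ?case using elim by (simp add: germ_eval_pCons algebra_simps)
  qed
qed

end

text \<open>The element \<open>q(z)\<close> is sent to the germ of \<open>q\<close> at a root
  \<open>r\<close> of the transported minimal polynomial \<open>m\<close>. Two choices of
  \<open>q\<close> differ by a multiple of \<open>m\<close>, which that germ annihilates; the limits
  are right because \<open>r\<close> tends to \<open>z\<close>.\<close>

lemma germ_hom_adjoin_simple_root:
  fixes \<tau> :: "'a::field topology" and F :: "'b filter"
  assumes \<tau>: "field_topology \<tau>" and ift: "polynomial_implicit_function_theorem \<tau>"
    and \<sigma>: "germ_hom \<tau> F M \<sigma>" and M: "is_subfield M" and z: "simple_root M z"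
  shows "\<exists>\<sigma>'. germ_hom \<tau> F (field_adjoin M {z}) \<sigma>' \<and> (\<forall>u\<in>M. \<forall>\<^sub>F t in F. \<sigma>' u t = \<sigma> u t)"
proof -
  note R = is_subfield_imp_subring[OF M]
  note za = simple_root_algebraic[OF z]
  obtain m where m: "m \<noteq> 0" "poly_over M m" "poly m z = 0"
    and min: "\<And>q. poly_over M q \<Longrightarrow> poly q z = 0 \<Longrightarrow> \<exists>s. poly_over M s \<and> q = m * s"
    using minimal_polynomial_exists[OF M za] by metis
  obtain P where P: "poly_over M P" "poly P z = 0" "poly (pderiv P) z \<noteq> 0"
    using z by (auto simp: simple_root_def)
  \<comment> \<open>At \<open>z\<close> the derivative of \<open>m * s\<close> is
    \<open>m' * s\<close>, so the simple root of \<open>P\<close> is also a simple root of the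
    minimal polynomial.\<close>
  obtain s where "P = m * s" using min P(1,2) by blast
  then have m': "poly (pderiv m) z \<noteq> 0" using P(3) m(3) by (auto simp: pderiv_mult)
  have lim: "limitin \<tau> (\<sigma> (poly.coeff m i)) (poly.coeff m i) F" for i
    using \<sigma> m(2) by (simp add: germ_hom_def poly_over_def)
  obtain r where r: "limitin \<tau> r z F"
    and root: "\<forall>\<^sub>F t in F. (\<Sum>i\<le>Polynomial.degree m. \<sigma> (poly.coeff m i) t * r t ^ i) = 0"
    using simple_root_continuous[OF field_topology_topspace[OF \<tau>] ift m(3) m' lim] by blast
  note ctxt = \<tau> \<sigma> M r
  have evm: "\<forall>\<^sub>F t in F. germ_eval \<sigma> r m t = 0"
    using root by (simp add: germ_eval_sum[OF ctxt])
  have wd: "\<forall>\<^sub>F t in F. germ_eval \<sigma> r p t = germ_eval \<sigma> r q t"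
    if pq: "poly_over M p" "poly_over M q" "poly p z = poly q z" for p q
  proof -
    obtain s where s: "poly_over M s" "p - q = m * s"
      using min[of "p - q"] poly_over_diff[OF R pq(1,2)] pq(3) by auto
    then have p: "p = q + m * s" by (simp add: algebra_simps)
    have "\<forall>\<^sub>F t in F. germ_eval \<sigma> r (q + m * s) t = germ_eval \<sigma> r q t + germ_eval \<sigma> r (m * s) t"
      by (intro germ_eval_add[OF ctxt] pq(2) poly_over_mult[OF R] m(2) s(1))
    moreover have "\<forall>\<^sub>F t in F. germ_eval \<sigma> r (m * s) t = germ_eval \<sigma> r m t * germ_eval \<sigma> r s t"
      by (intro germ_eval_mult[OF ctxt] m(2) s(1))
    ultimately show ?thesis using evm by eventually_elim (simp add: p)
  qed
  have "\<exists>q. poly_over M q \<and> poly q z = u" if "u \<in> field_adjoin M {z}" for u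
    using that field_adjoin_algebraic[OF M za] by (auto simp: simple_subring_def)
  then obtain N where N: "\<And>u. u \<in> field_adjoin M {z} \<Longrightarrow> poly_over M (N u)"
    "\<And>u. u \<in> field_adjoin M {z} \<Longrightarrow> poly (N u) z = u" by metis
  \<comment> \<open>The value at \<open>0\<close> is set by hand: \<open>germ_hom\<close> asks for
    \<open>0\<close> everywhere, while the chosen polynomial \<open>N 0\<close> gives it only
    eventually.\<close>
  define \<sigma>' where "\<sigma>' u t = (if u = 0 then 0 else germ_eval \<sigma> r (N u) t)" for u t
  have ad: "is_subfield (field_adjoin M {z})" by (rule is_subfield_field_adjoin)
  have \<sigma>': "\<forall>\<^sub>F t in F. \<sigma>' u t = germ_eval \<sigma> r q t" if "poly_over M q" "poly q z = u" for q u
  proof -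
    have "z \<in> field_adjoin M {z}" using field_adjoin_gen by blast
    then have u: "u \<in> field_adjoin M {z}"
      using that poly_over_eval[OF ad poly_over_mono[OF that(1) field_adjoin_base]] by blast
    show ?thesis
    proof (cases "u = 0")
      case True
      then show ?thesis
        using wd[OF poly_over_0[OF subfield_0[OF M]] that(1)] that(2)
        by (simp add: \<sigma>'_def germ_eval_0[OF ctxt])
    next
      case False
      then show ?thesis using wd[OF N(1)[OF u] that(1)] N(2)[OF u] that(2) by (simp add: \<sigma>'_def)
    qed
  qed
  have base: "\<forall>\<^sub>F t in F. \<sigma>' u t = \<sigma> u t" if "u \<in> M" for u
    using \<sigma>'[OF poly_over_const[OF R that]]
    by (simp add: germ_eval_pCons[OF ctxt] germ_eval_0[OF ctxt])
  have "limitin \<tau> (\<sigma>' u) u F" if u: "u \<in> field_adjoin M {z}" for u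
  proof (rule limitin_transform_eventually)
    show "\<forall>\<^sub>F t in F. germ_eval \<sigma> r (N u) t = \<sigma>' u t"
      using \<sigma>'[OF N(1)[OF u] N(2)[OF u]] by eventually_elim simp
    show "limitin \<tau> (germ_eval \<sigma> r (N u)) u F"
      using germ_eval_limit[OF ctxt N(1)[OF u]] N(2)[OF u] by simp
  qed
  moreover have "\<forall>\<^sub>F t in F. \<sigma>' 1 t = 1"
  proof -
    have "\<forall>\<^sub>F t in F. \<sigma> 1 t = 1" using \<sigma> by (simp add: germ_hom_def)
    with base[OF subfield_1[OF M]] show ?thesis by eventually_elim simp
  qed
  moreover have "(\<forall>\<^sub>F t in F. \<sigma>' (u + v) t = \<sigma>' u t + \<sigma>' v t) \<and> (\<forall>\<^sub>F t in F. \<sigma>' (u * v) t = \<sigma>' u t * \<sigma>' v t)"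
    if u: "u \<in> field_adjoin M {z}" and v: "v \<in> field_adjoin M {z}" for u v
  proof
    note Nu = N(1)[OF u] N(2)[OF u] and Nv = N(1)[OF v] N(2)[OF v]
    note eu = \<sigma>'[OF Nu] and ev = \<sigma>'[OF Nv]
    have "\<forall>\<^sub>F t in F. \<sigma>' (u + v) t = germ_eval \<sigma> r (N u + N v) t"
      by (rule \<sigma>'[OF poly_over_add[OF R Nu(1) Nv(1)]]) (simp add: Nu Nv)
    then show "\<forall>\<^sub>F t in F. \<sigma>' (u + v) t = \<sigma>' u t + \<sigma>' v t"
      using germ_eval_add[OF ctxt Nu(1) Nv(1)] eu ev by eventually_elim simp
    have "\<forall>\<^sub>F t in F. \<sigma>' (u * v) t = germ_eval \<sigma> r (N u * N v) t"
      by (rule \<sigma>'[OF poly_over_mult[OF R Nu(1) Nv(1)]]) (simp add: Nu Nv)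
    then show "\<forall>\<^sub>F t in F. \<sigma>' (u * v) t = \<sigma>' u t * \<sigma>' v t"
      using germ_eval_mult[OF ctxt Nu(1) Nv(1)] eu ev by eventually_elim simp
  qed
  moreover have "\<sigma>' 0 t = 0" for t by (simp add: \<sigma>'_def)
  ultimately have "germ_hom \<tau> F (field_adjoin M {z}) \<sigma>'"
    unfolding germ_hom_def by blast
  then show ?thesis using base by blast
qed

lemma germ_hom_separable_tower:
  assumes \<tau>: "field_topology \<tau>" and ift: "polynomial_implicit_function_theorem \<tau>"
    and \<sigma>: "germ_hom \<tau> F L \<sigma>" and L: "is_subfield L" and "separable_tower L M"
  shows "\<exists>\<sigma>'. germ_hom \<tau> F M \<sigma>' \<and> (\<forall>u\<in>L. \<forall>\<^sub>F t in F. \<sigma>' u t = \<sigma> u t)"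
  using assms(5)
proof (induction rule: separable_tower.induct)
  case base
  then show ?case using \<sigma> by (intro exI[of _ \<sigma>]) auto
next
  case (step M z)
  then obtain \<sigma>' where \<sigma>': "germ_hom \<tau> F M \<sigma>'" "\<And>u. u \<in> L \<Longrightarrow> \<forall>\<^sub>F t in F. \<sigma>' u t = \<sigma> u t"
    by blast
  obtain \<sigma>'' where \<sigma>'': "germ_hom \<tau> F (field_adjoin M {z}) \<sigma>''"
    "\<And>u. u \<in> M \<Longrightarrow> \<forall>\<^sub>F t in F. \<sigma>'' u t = \<sigma>' u t"
    using germ_hom_adjoin_simple_root[OF \<tau> ift \<sigma>'(1) separable_tower_subfield[OF step.hyps(1) L] step.hyps(2)]
    by blast
  have "\<forall>\<^sub>F t in F. \<sigma>'' u t = \<sigma> u t" if "u \<in> L" for u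
  proof -
    have "u \<in> M" using that separable_tower_subset[OF step.hyps(1)] by blast
    from \<sigma>''(2)[OF this] \<sigma>'(2)[OF that] show ?thesis by eventually_elim simp
  qed
  then show ?case using \<sigma>''(1) by blast
qed

text \<open>By transcendence of \<open>x\<close>, an element of \<open>D(x)\<close> determines a
  rational function over \<open>D\<close>, which is evaluated at the points \<open>t\<close> near
  \<open>x\<close>.\<close>

lemma germ_hom_transcendental:
  fixes \<tau> :: "'a::field topology"
  assumes V: "V_topology \<tau>" and D: "is_subfield D" and x: "x \<notin> relative_algebraic_closure D"
  defines "F \<equiv> nhdsin \<tau> x"
  shows "\<exists>\<sigma>. germ_hom \<tau> F (field_adjoin D {x}) \<sigma> \<and> (\<forall>u\<in>D. \<forall>\<^sub>F t in F. \<sigma> u t = u) \<and>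
           (\<forall>\<^sub>F t in F. \<sigma> x t = t)"
proof -
  note R = is_subfield_imp_subring[OF D]
  have \<tau>: "field_topology \<tau>" using V by (simp add: V_topology_def)
  note top = field_topology_topspace[OF \<tau>]
  have id: "limitin \<tau> (\<lambda>t. t) x F"
    using top by (auto simp: limitin_def F_def eventually_nhdsin)
  have poly_eq: "p = q" if "poly_over D p" "poly_over D q" "poly p x = poly q x" for p q
    using x that poly_over_diff[OF R that(1,2)]
    by (auto simp: relative_algebraic_closure_iff)
  \<comment> \<open>The finitely many roots of a denominator avoid a neighbourhood of
    \<open>x\<close>.\<close>
  have nz: "\<forall>\<^sub>F t in F. poly q t \<noteq> 0" if "poly q x \<noteq> 0" for q
  proof -
    have "q \<noteq> 0" using that by auto
    then show ?thesis
      using limitin_avoids_finite[OF V id poly_roots_finite[OF \<open>q \<noteq> 0\<close>]] that by simp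
  qed
  have wd: "\<forall>\<^sub>F t in F. poly p t / poly q t = poly p' t / poly q' t"
    if o: "poly_over D p" "poly_over D q" "poly_over D p'" "poly_over D q'"
      and n: "poly q x \<noteq> 0" "poly q' x \<noteq> 0" and e: "poly p x / poly q x = poly p' x / poly q' x"
    for p q p' q'
  proof -
    \<comment> \<open>Equality of values at the transcendental \<open>x\<close> is a formal
      identity, which then holds at every \<open>t\<close>.\<close>
    have "p * q' = p' * q"
      using o n e by (intro poly_eq poly_over_mult[OF R]) (simp_all add: field_simps)
    then have eq: "poly p t * poly q' t = poly p' t * poly q t" for t by (metis poly_mult)
    show ?thesis using nz[OF n(1)] nz[OF n(2)] by eventually_elim (simp add: frac_eq_eq eq)
  qed
  let ?L = "field_adjoin D {x}"
  have "\<exists>p q. poly_over D p \<and> poly_over D q \<and> poly q x \<noteq> 0 \<and> u = poly p x / poly q x" if "u \<in> ?L" for u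
    using that field_adjoin_subset_fractions[OF D, of x]
    by (force simp: fractions_def simple_subring_def)
  then obtain p q where pq: "\<And>u. u \<in> ?L \<Longrightarrow> poly_over D (p u)" "\<And>u. u \<in> ?L \<Longrightarrow> poly_over D (q u)"
    "\<And>u. u \<in> ?L \<Longrightarrow> poly (q u) x \<noteq> 0" "\<And>u. u \<in> ?L \<Longrightarrow> u = poly (p u) x / poly (q u) x"
    by metis
  define \<sigma> where "\<sigma> u t = (if u = 0 then 0 else poly (p u) t / poly (q u) t)" for u t
  have L: "is_subfield ?L" by (rule is_subfield_field_adjoin)
  have xL: "x \<in> ?L" using field_adjoin_gen by blast
  have val: "poly f x \<in> ?L" if "poly_over D f" for f
    by (rule poly_over_eval[OF L poly_over_mono[OF that field_adjoin_base] xL])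
  have \<sigma>: "\<forall>\<^sub>F t in F. \<sigma> u t = poly f t / poly g t"
    if fg: "poly_over D f" "poly_over D g" "poly g x \<noteq> 0" "u = poly f x / poly g x" for f g u
  proof (cases "u = 0")
    case True
    then have "f = 0" using fg by (intro poly_eq) (auto simp: poly_over_0 subfield_0[OF D])
    then show ?thesis using True by (simp add: \<sigma>_def)
  next
    case False
    have u: "u \<in> ?L" using fg val by (auto intro: subfield_divide[OF L])
    show ?thesis
      using wd[OF pq(1,2)[OF u] fg(1,2) pq(3)[OF u] fg(3)] pq(4)[OF u] fg(4) False
      by (simp add: \<sigma>_def)
  qed
  have poly_\<sigma>: "\<forall>\<^sub>F t in F. \<sigma> (poly f x) t = poly f t" if "poly_over D f" for f
    using \<sigma>[OF that poly_over_1[OF R], of "poly f x"] by simp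
  have "limitin \<tau> (\<sigma> u) u F" if u: "u \<in> ?L" for u
  proof (rule limitin_transform_eventually)
    show "\<forall>\<^sub>F t in F. poly (p u) t * inverse (poly (q u) t) = \<sigma> u t"
      using \<sigma>[OF pq[OF u]] by eventually_elim (simp add: divide_inverse)
    have "limitin \<tau> (\<lambda>t. poly (p u) t * inverse (poly (q u) t)) (poly (p u) x * inverse (poly (q u) x)) F"
      by (intro limitin_field_mult[OF \<tau>] limitin_field_inverse[OF \<tau>] limitin_field_poly[OF \<tau>] id
          pq(3)[OF u] nz)
    then show "limitin \<tau> (\<lambda>t. poly (p u) t * inverse (poly (q u) t)) u F"
      using pq(4)[OF u] by (simp add: divide_inverse)
  qed
  moreover have "\<forall>\<^sub>F t in F. \<sigma> 1 t = 1" using poly_\<sigma>[OF poly_over_1[OF R]] by simp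
  moreover have "(\<forall>\<^sub>F t in F. \<sigma> (u + v) t = \<sigma> u t + \<sigma> v t) \<and> (\<forall>\<^sub>F t in F. \<sigma> (u * v) t = \<sigma> u t * \<sigma> v t)"
    if u: "u \<in> ?L" and v: "v \<in> ?L" for u v
  proof
    note pu = pq[OF u] and pv = pq[OF v]
    have su: "\<forall>\<^sub>F t in F. \<sigma> u t = poly (p u) t / poly (q u) t" and sv: "\<forall>\<^sub>F t in F. \<sigma> v t = poly (p v) t / poly (q v) t"
      using \<sigma>[OF pu] \<sigma>[OF pv] by auto
    have "\<forall>\<^sub>F t in F. \<sigma> (u + v) t = poly (p u * q v + p v * q u) t / poly (q u * q v) t"
    proof (rule \<sigma>)
      have "poly (p u) x / poly (q u) x + poly (p v) x / poly (q v) x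
          = poly (p u * q v + p v * q u) x / poly (q u * q v) x"
        using pu(3) pv(3) by (simp add: add_frac_eq)
      then show "u + v = poly (p u * q v + p v * q u) x / poly (q u * q v) x"
        using pu(4) pv(4) by simp
    qed (use pu pv in \<open>auto intro!: poly_over_add[OF R] poly_over_mult[OF R]\<close>)
    then show "\<forall>\<^sub>F t in F. \<sigma> (u + v) t = \<sigma> u t + \<sigma> v t"
      using su sv nz[OF pu(3)] nz[OF pv(3)] by eventually_elim (simp add: add_frac_eq)
    have "\<forall>\<^sub>F t in F. \<sigma> (u * v) t = poly (p u * p v) t / poly (q u * q v) t"
    proof (rule \<sigma>)
      have "(poly (p u) x / poly (q u) x) * (poly (p v) x / poly (q v) x)
          = poly (p u * p v) x / poly (q u * q v) x" by simp
      then show "u * v = poly (p u * p v) x / poly (q u * q v) x"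
        using pu(4) pv(4) by simp
    qed (use pu pv in \<open>auto intro!: poly_over_mult[OF R]\<close>)
    then show "\<forall>\<^sub>F t in F. \<sigma> (u * v) t = \<sigma> u t * \<sigma> v t"
      using su sv by eventually_elim simp
  qed
  moreover have "\<sigma> 0 t = 0" for t by (simp add: \<sigma>_def)
  ultimately have "germ_hom \<tau> F ?L \<sigma>" unfolding germ_hom_def by blast
  moreover have "\<forall>\<^sub>F t in F. \<sigma> u t = u" if "u \<in> D" for u
    using poly_\<sigma>[OF poly_over_const[OF R that]] by simp
  moreover have "\<forall>\<^sub>F t in F. \<sigma> x t = t"
    using poly_\<sigma>[of "[:0, 1:]"] by (simp add: poly_over_0 subfield_0[OF D] subfield_1[OF D])
  ultimately show ?thesis by blast
qed

subsection \<open>Transfer of existential formulas\<close>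

lemma term_val_germ_hom:
  assumes \<sigma>: "germ_hom \<tau> F M \<sigma>" and M: "is_subfield M"
    and "\<And>i. i \<in> term_vars s \<Longrightarrow> e i \<in> M"
    and "\<And>i. i \<in> term_vars s \<Longrightarrow> \<forall>\<^sub>F t in F. e' t i = \<sigma> (e i) t"
  shows "term_val e s \<in> M \<and> (\<forall>\<^sub>F t in F. term_val (e' t) s = \<sigma> (term_val e s) t)"
  using assms(3,4)
proof (induction s)
  case (Minus s)
  then have IH: "term_val e s \<in> M" "\<forall>\<^sub>F t in F. term_val (e' t) s = \<sigma> (term_val e s) t" by auto
  from IH(2) germ_hom_uminus[OF \<sigma> M IH(1)]
  have "\<forall>\<^sub>F t in F. - term_val (e' t) s = \<sigma> (- term_val e s) t" by eventually_elim simp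
  then show ?case using IH(1) subfield_uminus[OF M] by simp
next
  case (Plus r s)
  then have r: "term_val e r \<in> M" "\<forall>\<^sub>F t in F. term_val (e' t) r = \<sigma> (term_val e r) t"
    and s: "term_val e s \<in> M" "\<forall>\<^sub>F t in F. term_val (e' t) s = \<sigma> (term_val e s) t" by auto
  have "\<forall>\<^sub>F t in F. \<sigma> (term_val e r + term_val e s) t = \<sigma> (term_val e r) t + \<sigma> (term_val e s) t"
    using \<sigma> r(1) s(1) by (simp add: germ_hom_def)
  with r(2) s(2) have "\<forall>\<^sub>F t in F. term_val (e' t) (Plus r s) = \<sigma> (term_val e (Plus r s)) t"
    by eventually_elim simp
  then show ?case using subfield_add[OF M r(1) s(1)] by simp
next
  case (Times r s)
  then have r: "term_val e r \<in> M" "\<forall>\<^sub>F t in F. term_val (e' t) r = \<sigma> (term_val e r) t"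
    and s: "term_val e s \<in> M" "\<forall>\<^sub>F t in F. term_val (e' t) s = \<sigma> (term_val e s) t" by auto
  have "\<forall>\<^sub>F t in F. \<sigma> (term_val e r * term_val e s) t = \<sigma> (term_val e r) t * \<sigma> (term_val e s) t"
    using \<sigma> r(1) s(1) by (simp add: germ_hom_def)
  with r(2) s(2) have "\<forall>\<^sub>F t in F. term_val (e' t) (Times r s) = \<sigma> (term_val e (Times r s)) t"
    by eventually_elim simp
  then show ?case using subfield_mult[OF M r(1) s(1)] by simp
next
  case One
  have "\<forall>\<^sub>F t in F. \<sigma> 1 t = 1" using \<sigma> by (simp add: germ_hom_def)
  then have "\<forall>\<^sub>F t in F. 1 = \<sigma> 1 t" by eventually_elim simp
  then show ?case using subfield_1[OF M] by simp
qed (use \<sigma> M in \<open>auto simp: germ_hom_def subfield_0\<close>)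

text \<open>An equivalence, rather than one implication, carries the induction through negation. A
  failing equation amounts to a nonzero difference, whose germ is eventually nonzero.\<close>

lemma quantifier_free_germ_hom:
  assumes \<sigma>: "germ_hom \<tau> F M \<sigma>" and M: "is_subfield M" and "quantifier_free \<phi>"
    and "\<And>i. i \<in> free_vars \<phi> \<Longrightarrow> e i \<in> M"
    and "\<And>i. i \<in> free_vars \<phi> \<Longrightarrow> \<forall>\<^sub>F t in F. e' t i = \<sigma> (e i) t"
  shows "\<forall>\<^sub>F t in F. holds (e' t) \<phi> \<longleftrightarrow> holds e \<phi>"
  using assms(3-5)
proof (induction \<phi>)
  case (Equal r s)
  have r: "term_val e r \<in> M" "\<forall>\<^sub>F t in F. term_val (e' t) r = \<sigma> (term_val e r) t"
    and s: "term_val e s \<in> M" "\<forall>\<^sub>F t in F. term_val (e' t) s = \<sigma> (term_val e s) t"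
    using term_val_germ_hom[OF \<sigma> M, of r e e'] term_val_germ_hom[OF \<sigma> M, of s e e'] Equal.prems by auto
  show ?case
  proof (cases "term_val e r = term_val e s")
    case True
    show ?thesis using r(2) s(2) by eventually_elim (use True in simp)
  next
    case False
    let ?u = "term_val e r + - term_val e s"
    have "?u \<noteq> 0" using False by simp
    moreover have u: "- term_val e s \<in> M" by (rule subfield_uminus[OF M s(1)])
    moreover have "?u \<in> M" by (rule subfield_add[OF M r(1) u])
    ultimately have "\<forall>\<^sub>F t in F. \<sigma> ?u t \<noteq> 0" by (intro germ_hom_nonzero[OF \<sigma> M])
    moreover have "\<forall>\<^sub>F t in F. \<sigma> ?u t = \<sigma> (term_val e r) t + \<sigma> (- term_val e s) t"
      using \<sigma> r(1) u unfolding germ_hom_def by blast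
    ultimately show ?thesis using r(2) s(2) germ_hom_uminus[OF \<sigma> M s(1)]
      by eventually_elim (use False in auto)
  qed
next
  case (Neg \<phi>)
  then have "\<forall>\<^sub>F t in F. holds (e' t) \<phi> \<longleftrightarrow> holds e \<phi>" by auto
  then show ?case by eventually_elim simp
next
  case (And \<phi> \<psi>)
  then have "\<forall>\<^sub>F t in F. holds (e' t) \<phi> \<longleftrightarrow> holds e \<phi>" "\<forall>\<^sub>F t in F. holds (e' t) \<psi> \<longleftrightarrow> holds e \<psi>" by auto
  then show ?case by eventually_elim simp
next
  case (Or \<phi> \<psi>)
  then have "\<forall>\<^sub>F t in F. holds (e' t) \<phi> \<longleftrightarrow> holds e \<phi>" "\<forall>\<^sub>F t in F. holds (e' t) \<psi> \<longleftrightarrow> holds e \<psi>" by auto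
  then show ?case by eventually_elim simp
qed simp

text \<open>\<open>Z\<close> collects witnesses for the existential quantifiers.\<close>

lemma existential_germ_hom:
  fixes \<tau> :: "'a::field topology"
  assumes "existential \<phi>" "holds e \<phi>"
  shows "\<exists>Z. finite Z \<and> (\<forall>(F :: 'a filter) M \<sigma> e'. germ_hom \<tau> F M \<sigma> \<longrightarrow> is_subfield M \<longrightarrow> Z \<subseteq> M \<longrightarrow>
     (\<forall>i\<in>free_vars \<phi>. e i \<in> M) \<longrightarrow> (\<forall>i\<in>free_vars \<phi>. \<forall>\<^sub>F t in F. e' t i = \<sigma> (e i) t) \<longrightarrow>
     (\<forall>\<^sub>F t in F. holds (e' t) \<phi>))"
  using assms
proof (induction arbitrary: e rule: existential.induct)
  case (1 \<phi>)
  have "\<forall>\<^sub>F t in F. holds (e' t) \<phi>"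
    if "germ_hom \<tau> F M \<sigma>" "is_subfield M" "\<forall>i\<in>free_vars \<phi>. e i \<in> M"
      "\<forall>i\<in>free_vars \<phi>. \<forall>\<^sub>F t in F. e' t i = \<sigma> (e i) t" for F :: "'a filter" and M \<sigma> e'
    using quantifier_free_germ_hom[OF that(1,2) 1(1), of e e'] that(3,4) 1(2) by simp
  then show ?case by (intro exI[of _ "{}"]) auto
next
  case (2 \<phi> i)
  from 2(3) obtain y where "holds (e(i := y)) \<phi>" by auto
  from 2(2)[OF this] obtain Z where Z: "finite Z" and
    IH: "\<And>(F :: 'a filter) M \<sigma> e'. germ_hom \<tau> F M \<sigma> \<Longrightarrow> is_subfield M \<Longrightarrow> Z \<subseteq> M \<Longrightarrow>
     (\<forall>j\<in>free_vars \<phi>. (e(i := y)) j \<in> M) \<Longrightarrow>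
     (\<forall>j\<in>free_vars \<phi>. \<forall>\<^sub>F t in F. e' t j = \<sigma> ((e(i := y)) j) t) \<Longrightarrow>
     (\<forall>\<^sub>F t in F. holds (e' t) \<phi>)" by blast
  have "\<forall>\<^sub>F t in F. holds (e' t) (Exists i \<phi>)"
    if h: "germ_hom \<tau> F M \<sigma>" "is_subfield M" "insert y Z \<subseteq> M" "\<forall>j\<in>free_vars (Exists i \<phi>). e j \<in> M"
      "\<forall>j\<in>free_vars (Exists i \<phi>). \<forall>\<^sub>F t in F. e' t j = \<sigma> (e j) t" for F :: "'a filter" and M \<sigma> e'
  proof -
    \<comment> \<open>The witness moves along: \<open>y\<close> is replaced by the value of its germ
      at \<open>t\<close>.\<close>
    have "\<forall>\<^sub>F t in F. holds ((e' t)(i := \<sigma> y t)) \<phi>"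
      using h by (intro IH[of F M \<sigma>]) auto
    then show ?thesis by eventually_elim auto
  qed
  then show ?case using Z by (intro exI[of _ "insert y Z"]) blast
qed

section \<open>The inclusion of the two closures\<close>

theorem corollary1p3:
  fixes \<tau> :: "'a::field topology" and B :: "'a set"
  assumes "henselian_topology \<tau>"
  shows "existential_algebraic_closure B
           \<subseteq> relative_algebraic_closure (Lambda UNIV (field_adjoin prime_subfield B))"
proof
  fix x assume "x \<in> existential_algebraic_closure B"
  then obtain S where S: "finite S" "existentially_definable B S" "x \<in> S"
    by (auto simp: existential_algebraic_closure_def)
  then obtain \<phi> e where \<phi>: "existential \<phi>" "e ` (free_vars \<phi> - {0}) \<subseteq> B" "S = {x. holds (e(0 := x)) \<phi>}"
    by (auto simp: existentially_definable_def)
  have V: "V_topology \<tau>" and ift: "polynomial_implicit_function_theorem \<tau>" and \<tau>: "field_topology \<tau>"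
    using assms by (auto simp: henselian_topology_def V_topology_def)
  define C where "C = Lambda UNIV (field_adjoin prime_subfield B)"
  have C: "is_subfield C" "mac_lane C" and BC: "B \<subseteq> C"
    using Lambda_properties[of "field_adjoin prime_subfield B"] field_adjoin_gen[of B prime_subfield]
    by (auto simp: C_def)
  have "x \<in> relative_algebraic_closure C"
  proof (rule ccontr)
    assume nx: "x \<notin> relative_algebraic_closure C"
    have "holds (e(0 := x)) \<phi>" using S(3) \<phi>(3) by simp
    \<comment> \<open>\<open>Z\<close> is fixed before any field or germ is chosen, so the tower can
      be made to contain it.\<close>
    then obtain Z where Z: "finite Z" and
      transfer: "\<And>(F :: 'a filter) M \<sigma> e'. germ_hom \<tau> F M \<sigma> \<Longrightarrow> is_subfield M \<Longrightarrow> Z \<subseteq> M \<Longrightarrow>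
        (\<forall>j\<in>free_vars \<phi>. (e(0 := x)) j \<in> M) \<Longrightarrow>
        (\<forall>j\<in>free_vars \<phi>. \<forall>\<^sub>F t in F. e' t j = \<sigma> ((e(0 := x)) j) t) \<Longrightarrow>
        (\<forall>\<^sub>F t in F. holds (e' t) \<phi>)"
      using existential_germ_hom[OF \<phi>(1), of "e(0 := x)" \<tau>] by blast
    obtain D s M where D: "is_subfield D" "C \<subseteq> D" "s \<notin> relative_algebraic_closure D"
      and alg: "s \<in> relative_algebraic_closure (field_adjoin D {x})"
      and tower: "separable_tower (field_adjoin D {s}) M" and ZM: "insert x Z \<subseteq> M"
      using separating_parameter[OF C, of "insert x Z" x] Z nx by auto
    define F where "F = nhdsin \<tau> s"
    obtain \<sigma>0 where \<sigma>0: "germ_hom \<tau> F (field_adjoin D {s}) \<sigma>0" "\<forall>u\<in>D. \<forall>\<^sub>F t in F. \<sigma>0 u t = u"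
      "\<forall>\<^sub>F t in F. \<sigma>0 s t = t"
      using germ_hom_transcendental[OF V D(1,3)] unfolding F_def by blast
    obtain \<sigma> where \<sigma>: "germ_hom \<tau> F M \<sigma>" "\<forall>u\<in>field_adjoin D {s}. \<forall>\<^sub>F t in F. \<sigma> u t = \<sigma>0 u t"
      using germ_hom_separable_tower[OF \<tau> ift \<sigma>0(1) is_subfield_field_adjoin tower] by blast
    have M: "is_subfield M" by (rule separable_tower_subfield[OF tower is_subfield_field_adjoin])
    have LM: "field_adjoin D {s} \<subseteq> M" by (rule separable_tower_subset[OF tower])
    have DL: "D \<subseteq> field_adjoin D {s}" and sL: "s \<in> field_adjoin D {s}"
      using field_adjoin_base field_adjoin_gen[of "{s}" D] by auto
    have fixD: "\<forall>\<^sub>F t in F. \<sigma> u t = u" if "u \<in> D" for u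
    proof -
      have "\<forall>\<^sub>F t in F. \<sigma> u t = \<sigma>0 u t" "\<forall>\<^sub>F t in F. \<sigma>0 u t = u" using that \<sigma>(2) \<sigma>0(2) DL by auto
      then show ?thesis by eventually_elim simp
    qed
    have \<sigma>s: "\<forall>\<^sub>F t in F. \<sigma> s t = t"
      using \<sigma>(2)[rule_format, OF sL] \<sigma>0(3) by eventually_elim simp
    have "\<forall>\<^sub>F t in F. holds (e(0 := \<sigma> x t)) \<phi>"
    proof (rule transfer[OF \<sigma>(1) M])
      show "Z \<subseteq> M" using ZM by simp
      \<comment> \<open>The parameters come from \<open>B\<close> and hence lie in \<open>D\<close>,
        where germs are constant; only the value of variable \<open>0\<close> moves.\<close>
      have eD: "e j \<in> D" if "j \<in> free_vars \<phi>" "j \<noteq> 0" for j using that \<phi>(2) BC D(2) by blast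
      then show "\<forall>j\<in>free_vars \<phi>. (e(0 := x)) j \<in> M" using DL LM ZM by auto
      show "\<forall>j\<in>free_vars \<phi>. \<forall>\<^sub>F t in F. (e(0 := \<sigma> x t)) j = \<sigma> ((e(0 := x)) j) t"
      proof
        fix j assume j: "j \<in> free_vars \<phi>"
        show "\<forall>\<^sub>F t in F. (e(0 := \<sigma> x t)) j = \<sigma> ((e(0 := x)) j) t"
        proof (cases "j = 0")
          case False
          then show ?thesis using fixD[OF eD[OF j False]] by (auto elim: eventually_mono)
        qed simp
      qed
    qed
    then have "\<forall>\<^sub>F t in F. \<sigma> x t \<in> S" using \<phi>(3) by simp
    moreover have "limitin \<tau> (\<sigma> x) x F" using \<sigma>(1) ZM by (simp add: germ_hom_def)
    \<comment> \<open>Among the finitely many elements of \<open>S\<close>, the limit property of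
      \<open>\<sigma>\<close> leaves only \<open>x\<close>.\<close>
    then have "\<forall>\<^sub>F t in F. \<sigma> x t \<notin> S - {x}"
      by (rule limitin_avoids_finite[OF V]) (use S(1) in auto)
    ultimately have "\<forall>\<^sub>F t in F. \<sigma> x t = x" by eventually_elim auto
    then have "field_adjoin D {x} \<subseteq> germ_fixed F M \<sigma>"
      using fixD DL LM ZM
      by (intro field_adjoin_least is_subfield_germ_fixed[OF \<sigma>(1) M]) (auto simp: germ_fixed_def)
    moreover obtain Q where Q: "Q \<noteq> 0" "poly_over (field_adjoin D {x}) Q" "poly Q s = 0"
      using alg by (auto simp: relative_algebraic_closure_iff)
    ultimately have QM: "poly_over (germ_fixed F M \<sigma>) Q" using poly_over_mono by blast
    \<comment> \<open>With coefficients whose germs are constant, moving \<open>s\<close> to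
      \<open>t\<close> moves \<open>q(s)\<close> to \<open>q(t)\<close>. For \<open>Q\<close> the
      former is \<open>0\<close>, so \<open>Q\<close> vanishes near \<open>s\<close>.\<close>
    have ev: "\<forall>\<^sub>F t in F. \<sigma> (poly q s) t = poly q t" if "poly_over (germ_fixed F M \<sigma>) q" for q
      using that
    proof (induction q)
      case 0
      then show ?case using \<sigma>(1) by (simp add: germ_hom_def)
    next
      case (pCons a q)
      then have "a \<in> germ_fixed F M \<sigma>" and qf: "poly_over (germ_fixed F M \<sigma>) q"
        and IH: "\<forall>\<^sub>F t in F. \<sigma> (poly q s) t = poly q t" by auto
      then have a: "a \<in> M" "\<forall>\<^sub>F t in F. \<sigma> a t = a" by (auto simp: germ_fixed_def)
      have q: "poly_over M q" by (rule poly_over_mono[OF qf]) (auto simp: germ_fixed_def)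
      have sM: "s \<in> M" "poly q s \<in> M" using sL LM poly_over_eval[OF M q] by auto
      have "\<forall>\<^sub>F t in F. \<sigma> (a + s * poly q s) t = \<sigma> a t + \<sigma> (s * poly q s) t"
        "\<forall>\<^sub>F t in F. \<sigma> (s * poly q s) t = \<sigma> s t * \<sigma> (poly q s) t"
        using \<sigma>(1) a(1) sM subfield_mult[OF M sM] by (auto simp: germ_hom_def)
      then show ?case using IH a(2) \<sigma>s by eventually_elim simp
    qed
    have "\<sigma> 0 t = 0" for t using \<sigma>(1) by (simp add: germ_hom_def)
    then have "\<forall>\<^sub>F t in F. poly Q t = 0" using ev[OF QM] Q(3) by simp
    then have "Q = 0" unfolding F_def by (rule eventually_root_imp_zero_poly[OF V])
    then show False using Q(1) by simp
  qed
  then show "x \<in> relative_algebraic_closure (Lambda UNIV (field_adjoin prime_subfield B))"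
    by (simp add: C_def)
qed

end
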